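(* Let $m>0$ be an integer and $q\in\{0,1\}$. Let $G=\langle x,y,z : x^{2m+q}=y^2=z^2=1,\ xy=yx,\ xz=zx,\ yz=zy\rangle\cong \mathbb{Z}_2^2\times\mathbb{Z}_{2m+q}$, a group of order $8m+4q$, and let $L_{8m+4q}$ be its Cayley table (rows and columns indexed by $G$, cell $(r,c)$ containing $rc$). Let $$L^*_{8m+4q}=\big(L_{8m+4q}\setminus\{(1,1,1),(1,y,y),(y,1,y),(y,y,1)\}\big)\cup\{(1,1,y),(1,y,1),(y,1,1),(y,y,y)\}.$$ Then $L^*_{8m+4q}$ is omniversal.
   Context: Latin squares are viewed as sets of triples $(r,c,s)$ with $s$ the symbol in cell $(r,c)$. A partial transversal is a set of triples containing at most one triple in each row, at most one in each column, and at most one with each symbol; its length is its number of triples. It is maximal if not contained in a longer partial transversal. A Latin square of order $n$ is omniversal if it has a maximal partial transversal of every length $\ell$ with $\lceil n/2\rceil\le\ell\le n$. *)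

theory Defs
  imports "HOL-Algebra.Algebra"
begin

text \<open>A triple \<open>(r, c, s)\<close> records that symbol \<open>s\<close> is in cell \<open>(r, c)\<close>. Rows, columns and
  symbols are all indexed by the same finite set \<open>A\<close>, so the order of the square is \<open>card A\<close>.\<close>

definition latin_square :: "'a set \<Rightarrow> ('a \<times> 'a \<times> 'a) set \<Rightarrow> bool" where
  "latin_square A L \<longleftrightarrow>
     finite A \<and> L \<subseteq> A \<times> A \<times> A \<and>
     (\<forall>r\<in>A. \<forall>c\<in>A. \<exists>!s. (r, c, s) \<in> L) \<and>
     (\<forall>r\<in>A. \<forall>s\<in>A. \<exists>!c. (r, c, s) \<in> L) \<and>
     (\<forall>c\<in>A. \<forall>s\<in>A. \<exists>!r. (r, c, s) \<in> L)"

definition partial_transversal :: "('a \<times> 'a \<times> 'a) set \<Rightarrow> ('a \<times> 'a \<times> 'a) set \<Rightarrow> bool" where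
  "partial_transversal L T \<longleftrightarrow>
     T \<subseteq> L \<and>
     inj_on (\<lambda>(r, c, s). r) T \<and> inj_on (\<lambda>(r, c, s). c) T \<and> inj_on (\<lambda>(r, c, s). s) T"

definition maximal_partial_transversal ::
  "('a \<times> 'a \<times> 'a) set \<Rightarrow> ('a \<times> 'a \<times> 'a) set \<Rightarrow> bool" where
  "maximal_partial_transversal L T \<longleftrightarrow>
     partial_transversal L T \<and>
     \<not> (\<exists>T'. partial_transversal L T' \<and> T \<subseteq> T' \<and> card T < card T')"

definition omniversal :: "'a set \<Rightarrow> ('a \<times> 'a \<times> 'a) set \<Rightarrow> bool" where
  "omniversal A L \<longleftrightarrow>
     latin_square A L \<and>
     (\<forall>l::nat. \<lceil>real (card A) / 2\<rceil> \<le> int l \<and> l \<le> card A \<longrightarrow>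
        (\<exists>T. maximal_partial_transversal L T \<and> card T = l))"

text \<open>A word is a list of letters; \<open>(a, True)\<close> stands for the generator \<open>a\<close> and \<open>(a, False)\<close>
  for its formal inverse.\<close>

type_synonym 'g gword = "('g \<times> bool) list"

text \<open>The equality of words forced by the group axioms and the relations \<open>R\<close>, a pair
  \<open>(u, v)\<close> in \<open>R\<close> being the relation \<open>u = v\<close>.\<close>

inductive word_eq :: "('g gword \<times> 'g gword) set \<Rightarrow> 'g gword \<Rightarrow> 'g gword \<Rightarrow> bool"
  for R where
  rel: "(u, v) \<in> R \<Longrightarrow> word_eq R u v"
| cancel: "word_eq R [(a, b), (a, \<not> b)] []"
| refl: "word_eq R u u"
| sym: "word_eq R u v \<Longrightarrow> word_eq R v u"
| trans: "word_eq R u v \<Longrightarrow> word_eq R v w \<Longrightarrow> word_eq R u w"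
| append: "word_eq R u v \<Longrightarrow> word_eq R u' v' \<Longrightarrow> word_eq R (u @ u') (v @ v')"

primrec word_val :: "('a, 'b) monoid_scheme \<Rightarrow> ('g \<Rightarrow> 'a) \<Rightarrow> 'g gword \<Rightarrow> 'a" where
  "word_val G f [] = \<one>\<^bsub>G\<^esub>"
| "word_val G f (p # w) =
     (if snd p then f (fst p) else inv\<^bsub>G\<^esub> (f (fst p))) \<otimes>\<^bsub>G\<^esub> word_val G f w"

text \<open>\<open>G\<close> is the group presented by \<open>R\<close> on generators indexed by the type \<open>'g\<close>, the generator
  named \<open>a\<close> being the element \<open>f a\<close>: the elements \<open>f a\<close> generate \<open>G\<close>, and two words have the
  same value exactly when the relations force them to be equal.  Equivalently, evaluation of
  words induces an isomorphism from the free group modulo the normal closure of \<open>R\<close> onto \<open>G\<close>.\<close>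

definition has_presentation ::
  "('a, 'b) monoid_scheme \<Rightarrow> ('g \<Rightarrow> 'a) \<Rightarrow> ('g gword \<times> 'g gword) set \<Rightarrow> bool" where
  "has_presentation G f R \<longleftrightarrow>
     group G \<and> range f \<subseteq> carrier G \<and> generate G (range f) = carrier G \<and>
     (\<forall>u v. word_val G f u = word_val G f v \<longleftrightarrow> word_eq R u v)"

datatype gen = Gen_x | Gen_y | Gen_z

definition gen_relations :: "nat \<Rightarrow> (gen gword \<times> gen gword) set" where
  "gen_relations k =
     {(replicate k (Gen_x, True), []),
      (replicate 2 (Gen_y, True), []),
      (replicate 2 (Gen_z, True), []),
      ([(Gen_x, True), (Gen_y, True)], [(Gen_y, True), (Gen_x, True)]),
      ([(Gen_x, True), (Gen_z, True)], [(Gen_z, True), (Gen_x, True)]),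
      ([(Gen_y, True), (Gen_z, True)], [(Gen_z, True), (Gen_y, True)])}"

definition cayley_table :: "('a, 'b) monoid_scheme \<Rightarrow> ('a \<times> 'a \<times> 'a) set" where
  "cayley_table G = {(r, c, r \<otimes>\<^bsub>G\<^esub> c) | r c. r \<in> carrier G \<and> c \<in> carrier G}"

definition L_star :: "('a, 'b) monoid_scheme \<Rightarrow> 'a \<Rightarrow> ('a \<times> 'a \<times> 'a) set" where
  "L_star G y =
     (cayley_table G - {(\<one>\<^bsub>G\<^esub>, \<one>\<^bsub>G\<^esub>, \<one>\<^bsub>G\<^esub>), (\<one>\<^bsub>G\<^esub>, y, y), (y, \<one>\<^bsub>G\<^esub>, y), (y, y, \<one>\<^bsub>G\<^esub>)})
     \<union> {(\<one>\<^bsub>G\<^esub>, \<one>\<^bsub>G\<^esub>, y), (\<one>\<^bsub>G\<^esub>, y, \<one>\<^bsub>G\<^esub>), (y, \<one>\<^bsub>G\<^esub>, \<one>\<^bsub>G\<^esub>), (y, y, y)}"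

end

theory Submission
  imports Defs
begin

text \<open>Fix a subgroup of index 2 and write \<open>k = 2m + q\<close>. A transversal of one of the four \<open>2k \<times> 2k\<close>
  blocks of the square, called the base, is a maximal partial transversal of length \<open>2k\<close>: the free
  rows and columns meet in the complementary block, which has the same symbols as the base block, and
  these are all used. Replacing a base entry \<open>(p, t, s)\<close> by \<open>(a, a', s)\<close>, \<open>(b, t, b')\<close>, \<open>(p, c, c')\<close> in the three other blocks keeps the rows, columns and symbols
  of the base block covered, hence keeps maximality, and adds 2 to the length. If \<open>k\<close> of these
  replacements are compatible with each other, all lengths \<open>2k, 2k + 2, \<dots>, 4k\<close> occur.

  The other parity is impossible in the group table itself. There the subgroup \<open>\<langle>x, z\<rangle>\<close>, which does
  not contain \<open>y\<close>, is used: the switched cell \<open>(y, y, y)\<close> lies in the base block but has a symbol from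
  the other coset. Adding it after moving the symbol of one base entry to the opposite block shifts all
  lengths by 1. For odd \<open>k\<close> the relevant subgroups are cyclic of even order and have no
  transversals, only near-transversals; a switched cell fills the gap.\<close>

section \<open>Maximality and the switching of base entries\<close>

text \<open>An entry of a longer \<open>T'\<close> outside \<open>T\<close> would share its row,
  column or symbol with an entry of \<open>T\<close>, against injectivity on
  \<open>T'\<close>.\<close>

lemma maximal_partial_transversalI:
  assumes pt: "partial_transversal L T"
    and block: "\<And>r c u. (r, c, u) \<in> L \<Longrightarrow>
      r \<in> (\<lambda>(r, c, s). r) ` T \<or> c \<in> (\<lambda>(r, c, s). c) ` T \<or> u \<in> (\<lambda>(r, c, s). s) ` T"
  shows "maximal_partial_transversal L T"
  unfolding maximal_partial_transversal_def
proof (intro conjI pt notI)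
  assume "\<exists>T'. partial_transversal L T' \<and> T \<subseteq> T' \<and> card T < card T'"
  then obtain T' where T': "partial_transversal L T'" "T \<subseteq> T'" "card T < card T'" by blast
  then obtain r c u where rcu: "(r, c, u) \<in> T'" "(r, c, u) \<notin> T"
    by (metis less_irrefl subset_antisym subsetI surj_pair)
  with T' have "(r, c, u) \<in> L" by (auto simp: partial_transversal_def)
  have inj: "inj_on (\<lambda>(r, c, s). r) T'" "inj_on (\<lambda>(r, c, s). c) T'" "inj_on (\<lambda>(r, c, s). s) T'"
    using T'(1) by (auto simp: partial_transversal_def)
  from block[OF \<open>(r, c, u) \<in> L\<close>] have "(r, c, u) \<in> T"
  proof (elim disjE imageE)
    fix w assume w: "w \<in> T"
    then have "w \<in> T'" using T'(2) by blast
    note eq = inj[THEN inj_onD, OF _ rcu(1) this]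
    show ?thesis if "r = (case w of (r, c, s) \<Rightarrow> r)" using w eq(1) that by (cases w) auto
    show ?thesis if "c = (case w of (r, c, s) \<Rightarrow> c)" using w eq(2) that by (cases w) auto
    show ?thesis if "u = (case w of (r, c, s) \<Rightarrow> s)" using w eq(3) that by (cases w) auto
  qed
  with rcu(2) show False by contradiction
qed

lemma partial_transversal_image:
  assumes "inj_on f A" "inj_on g A" "inj_on h A" "\<And>i. i \<in> A \<Longrightarrow> (f i, g i, h i) \<in> L"
  shows "partial_transversal L ((\<lambda>i. (f i, g i, h i)) ` A)"
  using assms unfolding partial_transversal_def inj_on_def by auto

lemma partial_transversal_Un:
  assumes "partial_transversal L S" "partial_transversal L T"
    and "(\<lambda>(r, c, s). r) ` S \<inter> (\<lambda>(r, c, s). r) ` T = {}"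
      "(\<lambda>(r, c, s). c) ` S \<inter> (\<lambda>(r, c, s). c) ` T = {}"
      "(\<lambda>(r, c, s). s) ` S \<inter> (\<lambda>(r, c, s). s) ` T = {}"
  shows "partial_transversal L (S \<union> T)"
  using assms unfolding partial_transversal_def inj_on_Un by blast

text \<open>Common bookkeeping for rows, columns and symbols of the switched set: the
  \<open>P\<close>s are images of pieces of the index set inside one base set \<open>U\<close>,
  while \<open>A\<close> and \<open>B\<close> collect the new values outside it.\<close>

lemma disjoint_pairs:
  assumes "P1 \<inter> P2 = {}" "P1 \<inter> P3 = {}" "P2 \<inter> P3 = {}" "P1 \<subseteq> U" "P2 \<subseteq> U" "P3 \<subseteq> U"
    "U \<inter> (A \<union> B) = {}" "A \<inter> B = {}"
  shows "P1 \<inter> A = {}" "P1 \<inter> B = {}" "A \<inter> P2 = {}" "A \<inter> P3 = {}" "B \<inter> P2 = {}" "B \<inter> P3 = {}"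
    "P2 \<inter> A = {}" "P2 \<inter> B = {}"
  using assms by blast+

text \<open>The indices in \<open>J\<close> are those whose base entry is replaced by three entries. For an index in \<open>K\<close>
  the cell \<open>(p, t)\<close> stays but has the foreign symbol \<open>b'\<close>, so that only the symbol \<open>s\<close> is moved.\<close>

lemma maximal_partial_transversal_of_switching:
  fixes I J K :: "'i set"
  assumes I: "finite I" "J \<union> K \<subseteq> I" "J \<inter> K = {}"
    and p: "bij_betw p I U" and t: "bij_betw t I V" and s: "bij_betw s I W"
    and row: "inj_on a (J \<union> K)" "inj_on b J" "a ` (J \<union> K) \<inter> b ` J = {}"
      "U \<inter> (a ` (J \<union> K) \<union> b ` J) = {}"
    and col: "inj_on a' (J \<union> K)" "inj_on c J" "a' ` (J \<union> K) \<inter> c ` J = {}"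
      "V \<inter> (a' ` (J \<union> K) \<union> c ` J) = {}"
    and sym: "inj_on b' (J \<union> K)" "inj_on c' J" "b' ` (J \<union> K) \<inter> c' ` J = {}"
      "W \<inter> (b' ` (J \<union> K) \<union> c' ` J) = {}"
    and L: "\<And>i. i \<in> I - J - K \<Longrightarrow> (p i, t i, s i) \<in> L"
      "\<And>i. i \<in> J \<union> K \<Longrightarrow> (a i, a' i, s i) \<in> L"
      "\<And>i. i \<in> J \<Longrightarrow> (b i, t i, b' i) \<in> L"
      "\<And>i. i \<in> J \<Longrightarrow> (p i, c i, c' i) \<in> L"
      "\<And>i. i \<in> K \<Longrightarrow> (p i, t i, b' i) \<in> L"
    and block: "\<And>r c u. (r, c, u) \<in> L \<Longrightarrow> r \<in> U \<or> c \<in> V \<or> u \<in> W \<or> u \<in> b' ` K"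
  shows "\<exists>T. maximal_partial_transversal L T \<and> card T = card I + 2 * card J + card K"
proof -
  let ?im = "\<lambda>f g h. (`) (\<lambda>i. (f i, g i, h i))"
  define T1 where "T1 = ?im p t s (I - J - K)"
  define T2 where "T2 = ?im a a' s (J \<union> K)"
  define T3 where "T3 = ?im b t b' J"
  define T4 where "T4 = ?im p c c' J"
  define T5 where "T5 = ?im p t b' K"
  define T where "T = T1 \<union> (T2 \<union> (T3 \<union> (T4 \<union> T5)))"
  note ds = T1_def T2_def T3_def T4_def T5_def
  have inj: "inj_on p I" "inj_on t I" "inj_on s I" using p t s by (auto simp: bij_betw_def)
  have im: "p ` I = U" "t ` I = V" "s ` I = W" using p t s by (auto simp: bij_betw_def)
  have injsub: "inj_on f A" if "inj_on f I" "A \<subseteq> I" for f :: "'i \<Rightarrow> 'x" and A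
    using that inj_on_subset by blast
  have pts: "partial_transversal L T1" "partial_transversal L T2" "partial_transversal L T3"
    "partial_transversal L T4" "partial_transversal L T5"
    unfolding ds
    by (intro partial_transversal_image L injsub[OF inj(1)] injsub[OF inj(2)] injsub[OF inj(3)]
        inj_on_subset[OF row(1)] row(2) col(2) sym(2)
        inj_on_subset[OF col(1)] inj_on_subset[OF sym(1)]; use I in auto)+
  have disj: "f ` A \<inter> f ` B = {}" if "inj_on f I" "A \<subseteq> I" "B \<subseteq> I" "A \<inter> B = {}"
    for f :: "'i \<Rightarrow> 'a" and A B
    using that inj_on_image_Int[OF that(1-3)] by simp
  have disjs: "f ` (I - J - K) \<inter> f ` J = {}" "f ` (I - J - K) \<inter> f ` K = {}" "f ` J \<inter> f ` K = {}"
    "f ` (I - J - K) \<inter> f ` (J \<union> K) = {}" if "inj_on f I" for f :: "'i \<Rightarrow> 'a"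
    by (rule disj[OF that]; use I in auto)+
  have sub: "f ` J \<subseteq> f ` I" "f ` K \<subseteq> f ` I" "f ` (I - J - K) \<subseteq> f ` I" "f ` (J \<union> K) \<subseteq> f ` I"
    for f :: "'i \<Rightarrow> 'a"
    using I by auto
  have b'JK: "b' ` J \<inter> b' ` K = {}"
    using inj_on_image_Int[OF sym(1), of J K] I(3) by simp
  have simps: "(\<lambda>(r, c, s). r) ` T1 = p ` (I - J - K)" "(\<lambda>(r, c, s). c) ` T1 = t ` (I - J - K)"
    "(\<lambda>(r, c, s). s) ` T1 = s ` (I - J - K)"
    "(\<lambda>(r, c, s). r) ` T2 = a ` (J \<union> K)" "(\<lambda>(r, c, s). c) ` T2 = a' ` (J \<union> K)"
    "(\<lambda>(r, c, s). s) ` T2 = s ` (J \<union> K)"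
    "(\<lambda>(r, c, s). r) ` T3 = b ` J" "(\<lambda>(r, c, s). c) ` T3 = t ` J"
    "(\<lambda>(r, c, s). s) ` T3 = b' ` J"
    "(\<lambda>(r, c, s). r) ` T4 = p ` J" "(\<lambda>(r, c, s). c) ` T4 = c ` J"
    "(\<lambda>(r, c, s). s) ` T4 = c' ` J"
    "(\<lambda>(r, c, s). r) ` T5 = p ` K" "(\<lambda>(r, c, s). c) ` T5 = t ` K"
    "(\<lambda>(r, c, s). s) ` T5 = b' ` K"
    unfolding ds by (simp_all add: image_image)
  have ptT: "partial_transversal L T"
    unfolding T_def
  proof (intro partial_transversal_Un pts; simp only: simps image_Un[of _ "T2"] image_Un[of _ "T3"] image_Un[of _ "T4"])
    note P = disjs[OF inj(1)]
    note Q = disjoint_pairs[OF P(1-3) sub(3,1,2)[of p, unfolded im] row(4,3)]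
    show "p ` (I - J - K) \<inter> (a ` (J \<union> K) \<union> (b ` J \<union> (p ` J \<union> p ` K))) = {}"
      "a ` (J \<union> K) \<inter> (b ` J \<union> (p ` J \<union> p ` K)) = {}"
      "b ` J \<inter> (p ` J \<union> p ` K) = {}" "p ` J \<inter> p ` K = {}"
      by (simp_all only: Int_Un_distrib P Q row(3) Un_empty simp_thms)
  next
    note P = disjs[OF inj(2)]
    note Q = disjoint_pairs[OF P(1-3) sub(3,1,2)[of t, unfolded im] col(4,3)]
    show "t ` (I - J - K) \<inter> (a' ` (J \<union> K) \<union> (t ` J \<union> (c ` J \<union> t ` K))) = {}"
      "a' ` (J \<union> K) \<inter> (t ` J \<union> (c ` J \<union> t ` K)) = {}"
      "t ` J \<inter> (c ` J \<union> t ` K) = {}" "c ` J \<inter> t ` K = {}"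
      by (simp_all only: Int_Un_distrib P Q col(3) Un_empty simp_thms)
  next
    \<comment> \<open>No base symbol is given up, because \<open>T2\<close> carries those of
      \<open>J \<union> K\<close>. So only two pieces lie inside \<open>W\<close>, and the third is
      taken to be empty.\<close>
    note P = disjs(4)[OF inj(3)]
    have "W \<inter> (b' ` J \<union> b' ` K \<union> c' ` J) = {}" "(b' ` J \<union> b' ` K) \<inter> c' ` J = {}"
      using sym(3,4) by (simp_all only: image_Un)
    note Q = disjoint_pairs[OF P _ _ sub(3,4)[of s, unfolded im] _ this, of "{}", simplified, unfolded image_Un Int_Un_distrib Int_Un_distrib2 Un_empty]
    show "s ` (I - J - K) \<inter> (s ` (J \<union> K) \<union> (b' ` J \<union> (c' ` J \<union> b' ` K))) = {}"
      "s ` (J \<union> K) \<inter> (b' ` J \<union> (c' ` J \<union> b' ` K)) = {}"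
      "b' ` J \<inter> (c' ` J \<union> b' ` K) = {}" "c' ` J \<inter> b' ` K = {}"
      using P sym(3) Q b'JK
      by (simp_all only: image_Un Int_Un_distrib Int_Un_distrib2 Un_empty simp_thms Int_commute[of "c' ` J" "b' ` K"])
  qed
  have cover: "f ` (I - J - K) \<union> f ` J \<union> f ` K = f ` I" for f :: "'i \<Rightarrow> 'a"
    unfolding image_Un[symmetric] using I(2) by (intro arg_cong[of _ _ "image f"]) blast
  \<comment> \<open>Counting by rows is easiest: \<open>T1\<close>, \<open>T4\<close> and
    \<open>T5\<close> together use exactly \<open>U\<close>, and \<open>T2\<close> and
    \<open>T3\<close> add the rows outside it.\<close>
  have "card T = card ((\<lambda>(r, c, s). r) ` T)"
    using ptT by (simp add: partial_transversal_def card_image)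
  also have "(\<lambda>(r, c, s). r) ` T = U \<union> (a ` (J \<union> K) \<union> b ` J)"
    unfolding T_def image_Un[of _ "T1"] image_Un[of _ "T2"] image_Un[of _ "T3"] image_Un[of _ "T4"] simps
      cover[of p, unfolded im, symmetric] by (simp only: Un_ac)
  also have "card \<dots> = card U + (card (J \<union> K) + card J)"
    using row I finite_subset[OF I(2,1)] p
    by (simp add: card_Un_disjoint card_image bij_betw_finite)
  also have "card U = card I" using p by (simp add: bij_betw_same_card)
  also have "card (J \<union> K) = card J + card K"
    using I finite_subset[OF I(2,1)] by (simp add: card_Un_disjoint)
  finally have "card T = card I + 2 * card J + card K" by simp
  moreover have "U \<subseteq> (\<lambda>(r, c, s). r) ` T" "V \<subseteq> (\<lambda>(r, c, s). c) ` T"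
    "W \<subseteq> (\<lambda>(r, c, s). s) ` T" "b' ` K \<subseteq> (\<lambda>(r, c, s). s) ` T"
    unfolding T_def image_Un[of _ "T1"] image_Un[of _ "T2"] image_Un[of _ "T3"] image_Un[of _ "T4"] simps
      cover[symmetric, of p, unfolded im] cover[symmetric, of t, unfolded im]
      cover[symmetric, of s, unfolded im] image_Un[of s J K]
    by (simp_all only: Un_subset_iff Un_ac Un_upper1 Un_upper2 simp_thms sup.coboundedI1 sup.coboundedI2 order.refl)
  then have "maximal_partial_transversal L T"
    using block by (intro maximal_partial_transversalI ptT) (meson subsetD)
  ultimately show ?thesis by blast
qed

section \<open>Switching data on Z_2 x Z_k\<close>

abbreviation add_mod :: "int \<Rightarrow> bool \<times> int \<Rightarrow> bool \<times> int \<Rightarrow> bool \<times> int" where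
  "add_mod k g h \<equiv> (fst g \<noteq> fst h, (snd g + snd h) mod k)"

text \<open>The relation \<open>s h = p h + t h\<close> is waived for the index \<open>e\<close>, whose base cell is going to be a
  switched one.\<close>

locale switching_data =
  fixes k :: int
    and e :: "bool \<times> int" and M :: "(bool \<times> int) set"
    and p t s a a' b b' c c' :: "bool \<times> int \<Rightarrow> bool \<times> int"
  fixes H :: "(bool \<times> int) set"
  defines "H \<equiv> UNIV \<times> {0..<k}"
  assumes k: "k \<ge> 2"
    and M: "M \<subseteq> H" "card M = nat k" "e \<in> M"
    and base: "inj_on p H" "p ` H \<subseteq> H" "inj_on t H" "t ` H \<subseteq> H" "inj_on s H" "s ` H \<subseteq> H"
    and row: "inj_on a M" "inj_on b M" "a ` M \<inter> b ` M = {}" "a ` M \<subseteq> H" "b ` M \<subseteq> H"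
    and col: "inj_on a' M" "inj_on c M" "a' ` M \<inter> c ` M = {}" "a' ` M \<subseteq> H" "c ` M \<subseteq> H"
    and sym: "inj_on b' M" "inj_on c' M" "b' ` M \<inter> c' ` M = {}" "b' ` M \<subseteq> H" "c' ` M \<subseteq> H"
    and s_eq: "\<And>h. h \<in> H \<Longrightarrow> h \<noteq> e \<Longrightarrow> s h = add_mod k (p h) (t h)"
    and s_eq': "\<And>h. h \<in> M \<Longrightarrow> s h = add_mod k (a h) (a' h)"
    and b'_eq: "\<And>h. h \<in> M \<Longrightarrow> b' h = add_mod k (b h) (t h)"
    and c'_eq: "\<And>h. h \<in> M \<Longrightarrow> c' h = add_mod k (p h) (c h)"
begin

lemma finite_H: "finite H"
  by (simp add: H_def)

lemma card_H: "card H = 2 * nat k"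
  by (simp add: H_def card_cartesian_product)

text \<open>Each coordinate gets one embedding for the base coset and one for the other coset. The
  maps \<open>p\<close>, \<open>t\<close>, \<open>s\<close> are injective self-maps of the finite
  set \<open>H\<close>, hence permutations, so the base cosets are covered completely. Membership in
  \<open>L\<close> stays a hypothesis, as it depends on where the embeddings put the switched
  cells.\<close>

lemma switching_embedded:
  fixes r_off r_base c_off c_base s_base s_off :: "bool \<times> int \<Rightarrow> 'a"
  assumes inj: "inj_on r_off H" "inj_on r_base H" "inj_on c_off H" "inj_on c_base H" "inj_on s_base H" "inj_on s_off H"
    and disj: "r_base ` H \<inter> r_off ` H = {}" "c_base ` H \<inter> c_off ` H = {}" "s_base ` H \<inter> s_off ` H = {}"
    and JK: "J \<union> K \<subseteq> M" "J \<inter> K = {}"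
    and L: "\<And>h. h \<in> H - J - K \<Longrightarrow> (r_base (p h), c_base (t h), s_base (s h)) \<in> L"
      "\<And>h. h \<in> J \<union> K \<Longrightarrow> (r_off (a h), c_off (a' h), s_base (s h)) \<in> L"
      "\<And>h. h \<in> J \<Longrightarrow> (r_off (b h), c_base (t h), s_off (b' h)) \<in> L"
      "\<And>h. h \<in> J \<Longrightarrow> (r_base (p h), c_off (c h), s_off (c' h)) \<in> L"
      "\<And>h. h \<in> K \<Longrightarrow> (r_base (p h), c_base (t h), s_off (b' h)) \<in> L"
    and block: "\<And>r c u. (r, c, u) \<in> L \<Longrightarrow>
      r \<in> r_base ` H \<or> c \<in> c_base ` H \<or> u \<in> s_base ` H \<or> u \<in> s_off ` b' ` K"
  shows "\<exists>T. maximal_partial_transversal L T \<and> card T = 2 * nat k + 2 * card J + card K"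
proof -
  have bij: "bij_betw (f \<circ> g) H (f ` H)" if "inj_on f H" "inj_on g H" "g ` H \<subseteq> H"
    for f :: "bool \<times> int \<Rightarrow> 'a" and g
    using that endo_inj_surj[OF finite_H that(3,2)] comp_inj_on[OF that(2), of f]
    unfolding bij_betw_def image_comp[symmetric] by metis
  have injc: "inj_on (f \<circ> g) S" if "inj_on f H" "inj_on g M" "g ` M \<subseteq> H" "S \<subseteq> M"
    for f :: "bool \<times> int \<Rightarrow> 'a" and g S
    using that by (meson comp_inj_on inj_on_subset image_mono subset_trans)
  have dis: "(f \<circ> g) ` (J \<union> K) \<inter> (f \<circ> g') ` J = {}"
    if f: "inj_on f H" and g: "g ` M \<inter> g' ` M = {}" "g ` M \<subseteq> H" "g' ` M \<subseteq> H"
    for f :: "bool \<times> int \<Rightarrow> 'a" and g g'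
  proof -
    have "(f \<circ> g) ` M \<inter> (f \<circ> g') ` M = {}"
      using inj_on_image_Int[OF f g(2,3)] g(1) by (simp add: image_comp)
    then show ?thesis
      using image_mono[OF JK(1), of "f \<circ> g"] image_mono[of J M "f \<circ> g'"] JK(1) by blast
  qed
  have dis': "S \<inter> ((f \<circ> g) ` (J \<union> K) \<union> (f \<circ> g') ` J) = {}"
    if f: "S \<inter> f ` H = {}" and g: "g ` M \<subseteq> H" "g' ` M \<subseteq> H"
    for f :: "bool \<times> int \<Rightarrow> 'a" and g g' S
  proof -
    have "(f \<circ> g) ` (J \<union> K) \<union> (f \<circ> g') ` J \<subseteq> f ` H"
      using JK(1) unfolding image_comp[symmetric] image_Un[symmetric]
      by (intro Un_least image_mono order_trans[OF image_mono g(1)] order_trans[OF image_mono g(2)]) auto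
    then show ?thesis using f by blast
  qed
  have J: "J \<subseteq> M" "J \<union> K \<subseteq> M" using JK(1) by auto
  have H: "J \<union> K \<subseteq> H" using JK(1) M(1) by blast
  note rows = injc[OF inj(1) row(1,4) J(2)] injc[OF inj(1) row(2,5) J(1)]
    dis[OF inj(1) row(3-5)] dis'[OF disj(1) row(4,5)]
  note cols = injc[OF inj(3) col(1,4) J(2)] injc[OF inj(3) col(2,5) J(1)]
    dis[OF inj(3) col(3-5)] dis'[OF disj(2) col(4,5)]
  note syms = injc[OF inj(6) sym(1,4) J(2)] injc[OF inj(6) sym(2,5) J(1)]
    dis[OF inj(6) sym(3-5)] dis'[OF disj(3) sym(4,5)]
  have "\<exists>T. maximal_partial_transversal L T \<and> card T = card H + 2 * card J + card K"
    by (rule maximal_partial_transversal_of_switching[OF finite_H H JK(2) bij[OF inj(2) base(1,2)]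
          bij[OF inj(4) base(3,4)] bij[OF inj(5) base(5,6)] rows cols syms])
      (simp_all only: o_apply L block[unfolded image_comp])
  then show ?thesis by (simp add: card_H)
qed

end

section \<open>Explicit tables for even and odd \<open>k\<close>\<close>

lemma mod_double_cases:
  fixes x k :: int
  assumes "0 \<le> x" "x < 2 * k"
  shows "x mod k = (if x < k then x else x - k)"
proof (cases "x < k")
  case False
  then have "x mod k = (x - k) mod k" by simp
  also have "\<dots> = x - k" using False assms by (intro mod_pos_pos_trivial) auto
  finally show ?thesis using False by simp
qed (use assms in simp)

lemma pred_mod_cases:
  fixes x k :: int
  assumes "0 \<le> x" "x < k"
  shows "(x - 1) mod k = (if x = 0 then k - 1 else x - 1)"
  using assms by (cases "x = 0") (auto simp: zmod_minus1)

text \<open>Both tables start from the columns \<open>(A i, i)\<close> for the rows \<open>(False, i)\<close>, where \<open>A\<close> separates the two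
  solutions of \<open>2 * i = l\<close> modulo an even \<open>k\<close> and is the parity of \<open>i\<close> for odd \<open>k\<close>.\<close>

lemma switching_data_even:
  assumes k: "k \<ge> (2::int)" "even k"
  shows "switching_data k (False, 0) ({False} \<times> {0..<k})
    (\<lambda>h. h)
    (\<lambda>(d, i). if d then (2 * ((i + 1) mod k) < k, (i + 1) mod k) else (k \<le> 2 * i, i))
    (\<lambda>(d, i). if d then (k \<le> 2 * ((i + 1) mod k), (2 * i + 1) mod k) else (k \<le> 2 * i, 2 * i mod k))
    (\<lambda>(d, i). (True, i)) (\<lambda>(d, i). (2 * i < k, i))
    (\<lambda>(d, i). (False, i)) (\<lambda>(d, i). (k \<le> 2 * i, 2 * i mod k))
    (\<lambda>(d, i). (k \<le> 2 * ((i + 1) mod k), (i + 1) mod k))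
    (\<lambda>(d, i). (k \<le> 2 * ((i + 1) mod k), (2 * i + 1) mod k))"
proof -
  obtain n where n: "k = 2 * n" using k by blast
  have m: "(i + 1) mod k = (if i + 1 < k then i + 1 else i + 1 - k)"
    "2 * i mod k = (if 2 * i < k then 2 * i else 2 * i - k)"
    "(2 * i + 1) mod k = (if 2 * i + 1 < k then 2 * i + 1 else 2 * i + 1 - k)"
    if "0 \<le> i" "i < k" for i
    using mod_double_cases[of "i + 1" k] mod_double_cases[of "2 * i" k]
      mod_double_cases[of "2 * i + 1" k] that n by auto
  have succ: "i = j" if "(i + 1) mod k = (j + 1) mod k" "0 \<le> i" "i < k" "0 \<le> j" "j < k" for i j
    using that by (auto simp: m split: if_splits)
  have double: "i = j" if "2 * i mod k = 2 * j mod k" "k \<le> 2 * i \<longleftrightarrow> k \<le> 2 * j"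
      "0 \<le> i" "i < k" "0 \<le> j" "j < k" for i j
    using that by (auto simp: m split: if_splits)
  \<comment> \<open>An odd symbol plus 1 is the double of the next index, which reduces the claim to
    \<open>double\<close> at \<open>i + 1\<close> and \<open>j + 1\<close>.\<close>
  have double1: "i = j" if "(2 * i + 1) mod k = (2 * j + 1) mod k"
      "k \<le> 2 * ((i + 1) mod k) \<longleftrightarrow> k \<le> 2 * ((j + 1) mod k)"
      "0 \<le> i" "i < k" "0 \<le> j" "j < k" for i j
  proof (rule succ)
    have step: "2 * ((i + 1) mod k) mod k = ((2 * i + 1) mod k + 1) mod k" for i
      unfolding mod_mult_right_eq mod_add_left_eq by (simp add: algebra_simps)
    show "(i + 1) mod k = (j + 1) mod k"
      by (rule double) (use that k in \<open>simp_all only: step, simp_all\<close>)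
  qed (use that in simp_all)
  \<comment> \<open>As \<open>k\<close> is even, residues have a parity. It separates the symbols
    \<open>s\<close> of the two kinds of rows, and also \<open>b'\<close> from
    \<open>c'\<close>.\<close>
  have even_odd: "2 * i mod k \<noteq> (2 * j + 1) mod k" for i j
    using dvd_mod_iff[of 2 k "2 * i"] dvd_mod_iff[of 2 k "2 * j + 1"] k by auto
  show ?thesis
    apply unfold_locales
    subgoal using k by simp
    subgoal by auto
    subgoal by (simp add: card_cartesian_product)
    subgoal using k by simp
    subgoal by simp
    subgoal by simp
    subgoal by (auto simp: inj_on_def intro: succ)
    subgoal using k by (auto split: if_splits)
    subgoal using even_odd even_odd[THEN not_sym] by (auto simp: inj_on_def intro: double double1)
    subgoal using k by (auto split: if_splits)
    subgoal by (auto simp: inj_on_def)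
    subgoal by (auto simp: inj_on_def)
    subgoal by auto
    subgoal by auto
    subgoal by auto
    subgoal by (auto simp: inj_on_def)
    subgoal by (auto simp: inj_on_def intro: succ)
    subgoal by force
    subgoal by auto
    subgoal using k by auto
    subgoal by (auto simp: inj_on_def intro: double)
    subgoal by (auto simp: inj_on_def intro: double1)
    subgoal using even_odd by auto
    subgoal using k by auto
    subgoal using k by auto
    subgoal by (auto simp: mod_simps algebra_simps split: if_splits)
    subgoal by (auto simp: mod_simps algebra_simps)
    subgoal by (auto simp: mod_simps algebra_simps)
    subgoal by (auto simp: mod_simps algebra_simps)
    done
qed

text \<open>Parity alternates along the cycle of length \<open>k\<close> except at the step from \<open>k - 1\<close> to \<open>0\<close>, which is where
  the exceptional index comes from.\<close>

lemma switching_data_odd: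
  assumes k: "k \<ge> (2::int)" "odd k"
  shows "switching_data k (True, k - 1) ({True} \<times> {0..<k})
    (\<lambda>(d, i). if d then (True, (i - 1) mod k) else (False, i))
    (\<lambda>(d, i). if d then (even ((i + 1) mod k), (i + 1) mod k) else (odd i, i))
    (\<lambda>(d, i). if d then (even i, 2 * i mod k) else (odd i, 2 * i mod k))
    (\<lambda>(d, i). (False, i)) (\<lambda>(d, i). (even i, i))
    (\<lambda>(d, i). (True, (i - 1) mod k)) (\<lambda>(d, i). (odd ((i + 1) mod k), 2 * i mod k))
    (\<lambda>(d, i). (odd ((i + 1) mod k), (i + 1) mod k))
    (\<lambda>(d, i). (even ((i + 1) mod k), 2 * i mod k))"
proof -
  obtain n where n: "k = 2 * n + 1" using k(2) by (auto elim: oddE)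
  have m: "(i + 1) mod k = (if i + 1 < k then i + 1 else i + 1 - k)"
    "2 * i mod k = (if 2 * i < k then 2 * i else 2 * i - k)"
    if "0 \<le> i" "i < k" for i
    using mod_double_cases[of "i + 1" k] mod_double_cases[of "2 * i" k] that by auto
  have succ: "i = j" if "(i + 1) mod k = (j + 1) mod k" "0 \<le> i" "i < k" "0 \<le> j" "j < k" for i j
    using that by (auto simp: m split: if_splits)
  have pred: "i = j" if "(i - 1) mod k = (j - 1) mod k" "0 \<le> i" "i < k" "0 \<le> j" "j < k" for i j
    using that by (auto simp: pred_mod_cases split: if_splits)
  have double: "i = j" if "2 * i mod k = 2 * j mod k" "0 \<le> i" "i < k" "0 \<le> j" "j < k" for i j
  proof -
    \<comment> \<open>If just one of two equal doubles wraps around, the doubles differ by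
      \<open>k\<close>, which is odd; so doubling is injective.\<close>
    have "even k" if "2 * i' = 2 * j' - k" for i' j'
    proof -
      from that have "k = 2 * (j' - i')" by simp
      then show ?thesis by simp
    qed
    then show ?thesis
      using that k(2) unfolding m(2)[OF that(2,3)] m(2)[OF that(4,5)]
      by (auto split: if_splits dest: HOL.sym)
  qed
  have parity: "even ((i + 1) mod k) \<longleftrightarrow> odd i" if "0 \<le> i" "i < k" "i \<noteq> k - 1" for i
    using that by (simp add: m)
  show ?thesis
    apply unfold_locales
    subgoal using k by simp
    subgoal by auto
    subgoal by (simp add: card_cartesian_product)
    subgoal using k by simp
    subgoal by (auto simp: inj_on_def intro: pred)
    subgoal using k by (auto split: if_splits)
    subgoal by (auto simp: inj_on_def intro: succ)
    subgoal using k by (auto split: if_splits)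
    subgoal by (auto simp: inj_on_def dest: double)
    subgoal using k by (auto split: if_splits)
    subgoal by (auto simp: inj_on_def)
    subgoal by (auto simp: inj_on_def intro: pred)
    subgoal by auto
    subgoal by auto
    subgoal using k by auto
    subgoal by (auto simp: inj_on_def)
    subgoal by (auto simp: inj_on_def intro: succ)
    subgoal by auto
    subgoal by auto
    subgoal using k by auto
    subgoal by (auto simp: inj_on_def intro: double)
    subgoal by (auto simp: inj_on_def intro: double)
    subgoal by (auto dest: double)
    subgoal using k by auto
    subgoal using k by auto
    subgoal for h by (cases h; cases "fst h") (auto simp: mod_simps parity)
    subgoal by (auto simp: mod_simps)
    subgoal by (auto simp: mod_simps)
    subgoal by (auto simp: mod_simps)
    done
qed

section \<open>The switched square in coordinates\<close>

text \<open>\<open>(u, v, i)\<close> stands for the group element \<open>y\<^sup>u z\<^sup>v x\<^sup>i\<close>; the exponent of \<open>y\<close> is flipped exactly on the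
  four switched cells.\<close>

definition switched_op :: "int \<Rightarrow> bool \<times> bool \<times> int \<Rightarrow> bool \<times> bool \<times> int \<Rightarrow> bool \<times> bool \<times> int" where
  "switched_op k = (\<lambda>(u, v, i) (u', v', j).
     ((u \<noteq> u') \<noteq> (\<not> v \<and> \<not> v' \<and> i = 0 \<and> j = 0), v \<noteq> v', (i + j) mod k))"

definition coords :: "int \<Rightarrow> (bool \<times> bool \<times> int) set" where
  "coords k = UNIV \<times> UNIV \<times> {0..<k}"

definition switched_square :: "int \<Rightarrow> ((bool \<times> bool \<times> int) \<times> (bool \<times> bool \<times> int) \<times> (bool \<times> bool \<times> int)) set" where
  "switched_square k = {(r, c, w). r \<in> coords k \<and> c \<in> coords k \<and> switched_op k r c = w}"

lemma switched_op_in_coords: "k > 0 \<Longrightarrow> switched_op k r c \<in> coords k"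
  by (auto simp: switched_op_def coords_def split: prod.split)

text \<open>Whether a cell is switched depends only on the exponents of \<open>z\<close> and
  \<open>x\<close>. For a given row and symbol, these two exponents of the column are found as in
  the group; they decide the flip, and then the exponent of \<open>y\<close> is determined.
  Commutativity exchanges rows and columns.\<close>

lemma latin_square_switched:
  assumes k: "k > 0"
  shows "latin_square (coords k) (switched_square k)"
proof -
  have comm: "switched_op k r c = switched_op k c r" for r c
    by (auto simp: switched_op_def add.commute split: prod.split)
  have solve: "\<exists>!c. c \<in> coords k \<and> switched_op k r c = w" if "r \<in> coords k" "w \<in> coords k" for r w
  proof -
    obtain u v i where r: "r = (u, v, i)" by (cases r)
    obtain u' v' l where w: "w = (u', v', l)" by (cases w)
    let ?j = "(l - i) mod k"
    have il: "0 \<le> i" "i < k" "0 \<le> l" "l < k" using that by (auto simp: r w coords_def)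
    have j: "(i + j) mod k = l \<longleftrightarrow> j = ?j" if "0 \<le> j" "j < k" for j
    proof
      assume "(i + j) mod k = l"
      then have "?j = ((i + j) mod k - i) mod k" by simp
      also have "\<dots> = j" using that by (simp add: mod_diff_left_eq)
      finally show "j = ?j" by simp
    next
      assume "j = ?j"
      then show "(i + j) mod k = l" using il by (simp add: mod_add_right_eq)
    qed
    have "?j \<in> {0..<k}" using k by simp
    let ?c = "((u' \<noteq> u) \<noteq> (\<not> v \<and> v = v' \<and> i = 0 \<and> ?j = 0), v \<noteq> v', ?j)"
    have iff: "switched_op k r (u2, v2, j2) = w \<longleftrightarrow> (u2, v2, j2) = ?c" if "0 \<le> j2" "j2 < k" for u2 v2 j2
      unfolding r w switched_op_def prod.case prod.inject j[OF that] by (cases u; cases v; cases v') auto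
    show ?thesis
    proof (rule ex1I[of _ ?c], intro conjI)
      show c: "?c \<in> coords k" using \<open>?j \<in> {0..<k}\<close> by (simp add: coords_def)
      show "switched_op k r ?c = w" using iff[of ?j] \<open>?j \<in> {0..<k}\<close> by simp
    next
      fix c assume "c \<in> coords k \<and> switched_op k r c = w"
      moreover obtain u2 v2 j2 where "c = (u2, v2, j2)" by (cases c)
      ultimately show "c = ?c" using iff[of j2 u2 v2] by (simp add: coords_def)
    qed
  qed
  have sub: "switched_square k \<subseteq> coords k \<times> coords k \<times> coords k"
    unfolding switched_square_def using switched_op_in_coords[OF k] by blast
  have mem: "(r, c, w) \<in> switched_square k \<longleftrightarrow> r \<in> coords k \<and> c \<in> coords k \<and> switched_op k r c = w"
    for r c w by (auto simp: switched_square_def)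
  have "\<forall>r\<in>coords k. \<forall>c\<in>coords k. \<exists>!w. (r, c, w) \<in> switched_square k"
    by (auto simp: mem)
  moreover have "\<forall>r\<in>coords k. \<forall>w\<in>coords k. \<exists>!c. (r, c, w) \<in> switched_square k"
    using solve by (simp add: mem)
  moreover have "\<forall>c\<in>coords k. \<forall>w\<in>coords k. \<exists>!r. (r, c, w) \<in> switched_square k"
  proof (intro ballI)
    fix c w assume *: "c \<in> coords k" "w \<in> coords k"
    show "\<exists>!r. (r, c, w) \<in> switched_square k"
      using solve[OF *] * by (simp add: mem comm[of _ c])
  qed
  moreover have "finite (coords k)" by (simp add: coords_def)
  ultimately show ?thesis using sub unfolding latin_square_def by blast
qed

section \<open>Embedding the tables into cosets\<close>

text \<open>\<open>emb_y\<close> and \<open>emb_z\<close> map \<open>bool \<times> {0..<k}\<close> onto a coset of \<open>\<langle>x, y\<rangle>\<close> and of \<open>\<langle>x, z\<rangle>\<close> respectively; \<open>w\<close>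
  selects the coset, \<open>d\<close> and \<open>n\<close> are translations.\<close>

definition emb_y :: "int \<Rightarrow> bool \<Rightarrow> bool \<Rightarrow> int \<Rightarrow> bool \<times> int \<Rightarrow> bool \<times> bool \<times> int" where
  "emb_y k w d n = (\<lambda>(u, i). (u \<noteq> d, w, (i + n) mod k))"

definition emb_z :: "int \<Rightarrow> bool \<Rightarrow> bool \<Rightarrow> int \<Rightarrow> bool \<times> int \<Rightarrow> bool \<times> bool \<times> int" where
  "emb_z k w d n = (\<lambda>(v, i). (w, v \<noteq> d, (i + n) mod k))"

lemma shift_mod_eq_iff:
  fixes i j k n :: int
  assumes "0 \<le> i" "i < k" "0 \<le> j" "j < k"
  shows "(i + n) mod k = (j + n) mod k \<longleftrightarrow> i = j"
proof
  assume "(i + n) mod k = (j + n) mod k"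
  then have "((i + n) mod k - n) mod k = ((j + n) mod k - n) mod k" by simp
  then show "i = j" using assms by (simp only: mod_diff_left_eq add_diff_cancel_right' mod_pos_pos_trivial)
qed simp

lemma shift_mod_surj:
  fixes i k n :: int
  assumes "0 \<le> i" "i < k"
  shows "\<exists>j\<in>{0..<k}. i = (j + n) mod k"
  by (rule bexI[of _ "(i - n) mod k"]) (use assms in \<open>simp_all add: mod_add_left_eq\<close>)

lemma inj_on_emb:
  "inj_on (emb_y k w d n) (UNIV \<times> {0..<k})" "inj_on (emb_z k w d n) (UNIV \<times> {0..<k})"
  by (auto simp: inj_on_def emb_y_def emb_z_def shift_mod_eq_iff)

text \<open>Translations permute a coset, so \<open>d\<close> and \<open>n\<close> can be chosen
  freely to steer cells towards or away from the switched ones.\<close>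

lemma image_emb:
  assumes "k > 0"
  shows "emb_y k w d n ` (UNIV \<times> {0..<k}) = {g \<in> coords k. fst (snd g) = w}"
    "emb_z k w d n ` (UNIV \<times> {0..<k}) = {g \<in> coords k. fst g = w}"
proof -
  have "(u, w, i) \<in> emb_y k w d n ` (UNIV \<times> {0..<k}) \<and> (w, u, i) \<in> emb_z k w d n ` (UNIV \<times> {0..<k})"
    if "0 \<le> i" "i < k" for u i
  proof -
    from shift_mod_surj[OF that] obtain j where "j \<in> {0..<k}" "i = (j + n) mod k" by blast
    then show ?thesis by (auto simp: emb_y_def emb_z_def intro!: image_eqI[of _ _ "(u \<noteq> d, j)"])
  qed
  then show "emb_y k w d n ` (UNIV \<times> {0..<k}) = {g \<in> coords k. fst (snd g) = w}"
    "emb_z k w d n ` (UNIV \<times> {0..<k}) = {g \<in> coords k. fst g = w}"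
    using assms by (auto simp: coords_def emb_y_def emb_z_def)
qed

lemma shift_mod_add:
  fixes i j k m n :: int
  shows "((i + m) mod k + (j + n) mod k) mod k = ((i + j) mod k + (m + n)) mod k"
proof -
  have "((i + m) mod k + (j + n) mod k) mod k = (i + j + (m + n)) mod k"
    unfolding mod_add_eq by (simp add: algebra_simps)
  then show ?thesis by (simp only: mod_add_left_eq)
qed

text \<open>Translating rows and columns translates the symbols by the sum. The last hypothesis
  keeps the cell away from the four switched ones: one of its coordinates involves \<open>z\<close>
  or a nonzero power of \<open>x\<close>.\<close>

lemma emb_y_mem:
  assumes "k > 0" "g'' = add_mod k g g'" "w'' = (w \<noteq> w')" "d'' = (d \<noteq> d')" "n'' = n + n'"
    and "w \<or> w' \<or> (snd g + n) mod k \<noteq> 0 \<or> (snd g' + n') mod k \<noteq> 0"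
  shows "(emb_y k w d n g, emb_y k w' d' n' g', emb_y k w'' d'' n'' g'') \<in> switched_square k"
  using assms
  by (cases g; cases g') (auto simp: switched_square_def emb_y_def coords_def switched_op_def shift_mod_add simp del: mod_add_eq mod_add_left_eq mod_add_right_eq)

lemma emb_z_mem:
  assumes "k > 0" "g'' = add_mod k g g'" "w'' = (w \<noteq> w')" "d'' = (d \<noteq> d')" "n'' = n + n'"
    and "fst g \<noteq> d \<or> fst g' \<noteq> d' \<or> (snd g + n) mod k \<noteq> 0 \<or> (snd g' + n') mod k \<noteq> 0"
  shows "(emb_z k w d n g, emb_z k w' d' n' g', emb_z k w'' d'' n'' g'') \<in> switched_square k"
  using assms
  by (cases g; cases g') (auto simp: switched_square_def emb_z_def coords_def switched_op_def shift_mod_add simp del: mod_add_eq mod_add_left_eq mod_add_right_eq)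

text \<open>Switching leaves the exponent of \<open>z\<close> alone, so the free rows and columns
  still meet only in symbols of the base symbol coset, for every choice of base block.\<close>

lemma emb_y_block:
  assumes "k > 0" "(r, c, u) \<in> switched_square k"
  shows "r \<in> emb_y k f d n ` (UNIV \<times> {0..<k}) \<or> c \<in> emb_y k g d' n' ` (UNIV \<times> {0..<k})
    \<or> u \<in> emb_y k (f \<noteq> g) d'' n'' ` (UNIV \<times> {0..<k})"
  using assms(2) switched_op_in_coords[OF assms(1), of r c] unfolding image_emb[OF assms(1)]
  by (auto simp: switched_square_def switched_op_def split: prod.splits)

text \<open>The free rows and columns form the subgroup \<langle>x, z\<rangle>, and the only
  switched cell there is (1, 1). Its foreign symbol \<open>y\<close> is the one that the added entry
  (y, y, y) uses up.\<close>

lemma emb_z_block: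
  assumes "k > 0" "(r, c, u) \<in> switched_square k"
  shows "r \<in> emb_z k True d n ` (UNIV \<times> {0..<k}) \<or> c \<in> emb_z k True d' n' ` (UNIV \<times> {0..<k})
    \<or> u \<in> emb_z k False d'' n'' ` (UNIV \<times> {0..<k}) \<or> u = (True, False, 0)"
  using assms(2) switched_op_in_coords[OF assms(1), of r c] unfolding image_emb[OF assms(1)]
  by (auto simp: switched_square_def switched_op_def split: prod.splits)

lemma image_emb_disjoint:
  assumes "k > 0" "w \<noteq> w'"
  shows "emb_y k w d n ` (UNIV \<times> {0..<k}) \<inter> emb_y k w' d' n' ` (UNIV \<times> {0..<k}) = {}"
    "emb_z k w d n ` (UNIV \<times> {0..<k}) \<inter> emb_z k w' d' n' ` (UNIV \<times> {0..<k}) = {}"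
  using assms(2) unfolding image_emb[OF assms(1)] by auto

section \<open>Maximal partial transversals of even and odd length\<close>

text \<open>The first claim uses cosets of \<langle>x, y\<rangle> and no switched cell. The second
  uses cosets of \<langle>x, z\<rangle> and the switched cell (y, y), whose index is excluded from
  \<open>J\<close> because it forms \<open>K\<close>.\<close>

lemma
  assumes k: "k \<ge> 2" "even k"
  shows maximal_even_deficiency_even: "J \<subseteq> {False} \<times> {0..<k} \<Longrightarrow>
      \<exists>T. maximal_partial_transversal (switched_square k) T \<and> card T = 2 * nat k + 2 * card J"
    and maximal_odd_deficiency_even: "J \<subseteq> {False} \<times> {0..<k} - {(False, 0)} \<Longrightarrow>
      \<exists>T. maximal_partial_transversal (switched_square k) T \<and> card T = 2 * nat k + 2 * card J + 1"
proof -
  have k0: "k > 0" using k by simp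
  interpret switching_data
    where k = k and e = "(False, 0)" and M = "{False} \<times> {0..<k}"
      and H = "UNIV \<times> {0..<k}" and p = "\<lambda>h. h"
      and t = "\<lambda>(d, i). if d then (2 * ((i + 1) mod k) < k, (i + 1) mod k) else (k \<le> 2 * i, i)"
      and s = "\<lambda>(d, i). if d then (k \<le> 2 * ((i + 1) mod k), (2 * i + 1) mod k) else (k \<le> 2 * i, 2 * i mod k)"
      and a = "\<lambda>(d, i). (True, i)" and a' = "\<lambda>(d, i). (2 * i < k, i)"
      and b = "\<lambda>(d, i). (False, i)" and b' = "\<lambda>(d, i). (k \<le> 2 * i, 2 * i mod k)"
      and c = "\<lambda>(d, i). (k \<le> 2 * ((i + 1) mod k), (i + 1) mod k)"
      and c' = "\<lambda>(d, i). (k \<le> 2 * ((i + 1) mod k), (2 * i + 1) mod k)"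
    by (rule switching_data_even[OF k]) simp
  show "\<exists>T. maximal_partial_transversal (switched_square k) T \<and> card T = 2 * nat k + 2 * card J"
    if J: "J \<subseteq> {False} \<times> {0..<k}"
  proof -
    \<comment> \<open>The base rows and columns lie in the coset of \<open>z\<close>, so only the
      entries carrying moved symbols could be switched cells. With the columns shifted by 1 their
      \<open>x\<close>-exponents are \<open>i\<close> and \<open>i + 1\<close>, which do not both
      vanish since \<open>k \<ge> 2\<close>.\<close>
    have nz: "i mod k \<noteq> 0 \<or> (i + 1) mod k \<noteq> 0" if "0 \<le> i" "i < k" for i
      using that k by (cases "i = 0") simp_all
    have "\<exists>T. maximal_partial_transversal (switched_square k) T \<and> card T = 2 * nat k + 2 * card J + card ({} :: (bool \<times> int) set)"
      apply (rule switching_embedded[where r_off = "emb_y k False False 0" and r_base = "emb_y k True False 0"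
          and c_off = "emb_y k False False 1" and c_base = "emb_y k True False 1"
          and s_base = "emb_y k False False 1" and s_off = "emb_y k True False 1"])
      apply (simp_all only: inj_on_emb)
      subgoal by (rule image_emb_disjoint(1)[OF k0]) simp
      subgoal by (rule image_emb_disjoint(1)[OF k0]) simp
      subgoal by (rule image_emb_disjoint(1)[OF k0]) simp
      subgoal using J by simp
      subgoal by simp
      subgoal for h using s_eq[of h] k by (intro emb_y_mem[OF k0]) (auto split: if_splits)
      subgoal for h
      proof -
        assume "h \<in> J \<union> {}"
        with J obtain i where "h = (False, i)" "0 \<le> i" "i < k" by auto
        then show ?thesis using s_eq'[of h] nz[of i] by (intro emb_y_mem[OF k0]) simp_all
      qed
      subgoal for h using b'_eq[of h] k J by (intro emb_y_mem[OF k0]) (auto split: if_splits)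
      subgoal for h using c'_eq[of h] k J by (intro emb_y_mem[OF k0]) (auto split: if_splits)
      subgoal by simp
      subgoal for r c u using emb_y_block[OF k0, of r c u True False 0 True False 1 False 1] by simp
      done
    then show ?thesis by simp
  qed
  show "\<exists>T. maximal_partial_transversal (switched_square k) T \<and> card T = 2 * nat k + 2 * card J + 1"
    if J: "J \<subseteq> {False} \<times> {0..<k} - {(False, 0)}"
  proof -
    \<comment> \<open>Without translations the index \<open>(False, 0)\<close> has base cell (y, y).
      It now carries \<open>y\<close>, and its group symbol 1 moves to the cell (z, z) of the
      opposite block.\<close>
    have e: "(True, False, 0) = emb_z k True False 0 (False, 0)"
      by (simp add: emb_z_def)
    have Jd: "\<exists>i. h = (False, i) \<and> 0 \<le> i \<and> i < k \<and> i \<noteq> 0" if "h \<in> J" for h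
      using subsetD[OF J that] by auto
    have "\<exists>T. maximal_partial_transversal (switched_square k) T \<and> card T = 2 * nat k + 2 * card J + card {(False, 0 :: int)}"
      apply (rule switching_embedded[where r_off = "emb_z k False False 0" and r_base = "emb_z k True False 0"
          and c_off = "emb_z k False False 0" and c_base = "emb_z k True False 0"
          and s_base = "emb_z k False False 0" and s_off = "emb_z k True False 0"])
      apply (simp_all only: inj_on_emb)
      subgoal by (rule image_emb_disjoint(2)[OF k0]) simp
      subgoal by (rule image_emb_disjoint(2)[OF k0]) simp
      subgoal by (rule image_emb_disjoint(2)[OF k0]) simp
      subgoal by (intro Un_least subset_trans[OF J]) (use k in auto)
      subgoal using J by blast
      subgoal for h
      proof (rule emb_z_mem[OF k0])
        assume h: "h \<in> UNIV \<times> {0..<k} - J - {(False, 0)}"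
        then show "fst h \<noteq> False \<or> fst (case h of (d, i) \<Rightarrow>
            if d then (2 * ((i + 1) mod k) < k, (i + 1) mod k) else (k \<le> 2 * i, i)) \<noteq> False \<or>
          (snd h + 0) mod k \<noteq> 0 \<or> (snd (case h of (d, i) \<Rightarrow>
            if d then (2 * ((i + 1) mod k) < k, (i + 1) mod k) else (k \<le> 2 * i, i)) + 0) mod k \<noteq> 0"
          by (cases h) auto
      qed (use s_eq[of h] in simp_all)
      subgoal for h
      proof -
        assume "h \<in> J \<union> {(False, 0)}"
        with J k obtain i where "h = (False, i)" "0 \<le> i" "i < k" by auto
        then show ?thesis using s_eq'[of h] by (intro emb_z_mem[OF k0]) simp_all
      qed
      subgoal for h
      proof -
        assume "h \<in> J"
        then obtain i where "h = (False, i)" "0 \<le> i" "i < k" "i \<noteq> 0" using Jd by blast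
        then show ?thesis using b'_eq[of h] by (intro emb_z_mem[OF k0]) simp_all
      qed
      subgoal for h
      proof -
        assume "h \<in> J"
        then obtain i where "h = (False, i)" "0 \<le> i" "i < k" "i \<noteq> 0" using Jd by blast
        then show ?thesis using c'_eq[of h] by (intro emb_z_mem[OF k0]) simp_all
      qed
      subgoal using k by (simp add: emb_z_def switched_square_def switched_op_def coords_def)
      subgoal for r c u using emb_z_block[OF k0, of r c u False 0 False 0 False 0] k by (simp add: e)
      done
    then show ?thesis by simp
  qed
qed

text \<open>The table breaks the group law only in the base cell of index
  \<open>(True, k - 1)\<close>. The row shift by 2 and the flips steer this cell to (1, 1) in the
  first claim, where it is a genuine entry, and to (y, y) in the second, where it forms
  \<open>K\<close>.\<close>

lemma
  assumes k: "k \<ge> 2" "odd k"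
  shows maximal_even_deficiency_odd: "J \<subseteq> {True} \<times> {0..<k} \<Longrightarrow>
      \<exists>T. maximal_partial_transversal (switched_square k) T \<and> card T = 2 * nat k + 2 * card J"
    and maximal_odd_deficiency_odd: "J \<subseteq> {True} \<times> {0..<k} - {(True, k - 1)} \<Longrightarrow>
      \<exists>T. maximal_partial_transversal (switched_square k) T \<and> card T = 2 * nat k + 2 * card J + 1"
proof -
  have k0: "k > 0" using k by simp
  interpret switching_data
    where k = k and e = "(True, k - 1)" and M = "{True} \<times> {0..<k}"
      and H = "UNIV \<times> {0..<k}"
      and p = "\<lambda>(d, i). if d then (True, (i - 1) mod k) else (False, i)"
      and t = "\<lambda>(d, i). if d then (even ((i + 1) mod k), (i + 1) mod k) else (odd i, i)"
      and s = "\<lambda>(d, i). if d then (even i, 2 * i mod k) else (odd i, 2 * i mod k)"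
      and a = "\<lambda>(d, i). (False, i)" and a' = "\<lambda>(d, i). (even i, i)"
      and b = "\<lambda>(d, i). (True, (i - 1) mod k)" and b' = "\<lambda>(d, i). (odd ((i + 1) mod k), 2 * i mod k)"
      and c = "\<lambda>(d, i). (odd ((i + 1) mod k), (i + 1) mod k)"
      and c' = "\<lambda>(d, i). (even ((i + 1) mod k), 2 * i mod k)"
    by (rule switching_data_odd[OF k]) simp
  show "\<exists>T. maximal_partial_transversal (switched_square k) T \<and> card T = 2 * nat k + 2 * card J"
    if J: "J \<subseteq> {True} \<times> {0..<k}"
  proof -
    \<comment> \<open>Base entries with first bit \<open>False\<close> have
      \<open>x\<close>-exponents \<open>i + 2\<close> and \<open>i\<close>; for these not to vanish
      together, 2 must be nonzero modulo \<open>k\<close>.\<close>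
    have k3: "k \<ge> 3" using assms(1,2) by presburger
    have i1: "(i + 1) mod k \<noteq> 0" if "0 \<le> i" "i < k" "i \<noteq> k - 1" for i
      using mod_double_cases[of "i + 1" k] that by auto
    have "\<exists>T. maximal_partial_transversal (switched_square k) T \<and> card T = 2 * nat k + 2 * card J + card ({} :: (bool \<times> int) set)"
      apply (rule switching_embedded[where r_off = "emb_y k True True 2" and r_base = "emb_y k False True 2"
          and c_off = "emb_y k True True 0" and c_base = "emb_y k False True 0"
          and s_base = "emb_y k False False 2" and s_off = "emb_y k True False 2"])
      apply (simp_all only: inj_on_emb)
      subgoal by (rule image_emb_disjoint(1)[OF k0]) simp
      subgoal by (rule image_emb_disjoint(1)[OF k0]) simp
      subgoal by (rule image_emb_disjoint(1)[OF k0]) simp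
      subgoal using J by simp
      subgoal by simp
      subgoal for h
      proof (cases "h = (True, k - 1)")
        \<comment> \<open>Row and column become 1 and the symbol \<open>s h\<close> becomes
          \<open>y\<close>, so this is the switched entry (1, 1, y).\<close>
        case True
        then show ?thesis
          using assms(1,2) by (simp add: emb_y_def switched_square_def switched_op_def coords_def mod_simps)
      next
        case False
        assume "h \<in> UNIV \<times> {0..<k} - J - {}"
        then obtain d i where h: "h = (d, i)" "0 \<le> i" "i < k" by auto
        have "i \<noteq> k - 1" if d using h False that by simp
        then have "(i + 1) mod k \<noteq> 0" if d using h that i1 by simp
        moreover have "(i + 2) mod k \<noteq> 0 \<or> i mod k \<noteq> 0" using h k3 by (cases "i = 0") simp_all
        ultimately show ?thesis
          using s_eq[of h] h False by (intro emb_y_mem[OF k0]; cases d) (simp_all add: mod_simps)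
      qed
      subgoal for h using s_eq'[of h] k J by (intro emb_y_mem[OF k0]) (auto split: if_splits)
      subgoal for h using b'_eq[of h] k J by (intro emb_y_mem[OF k0]) (auto split: if_splits)
      subgoal for h using c'_eq[of h] k J by (intro emb_y_mem[OF k0]) (auto split: if_splits)
      subgoal by simp
      subgoal for r c u using emb_y_block[OF k0, of r c u False True 2 False True 0 False 2] by simp
      done
    then show ?thesis by simp
  qed
  show "\<exists>T. maximal_partial_transversal (switched_square k) T \<and> card T = 2 * nat k + 2 * card J + 1"
    if J: "J \<subseteq> {True} \<times> {0..<k} - {(True, k - 1)}"
  proof -
    \<comment> \<open>The exceptional index lands on (y, y, y), and the right-hand side is its
      \<open>b'\<close> after embedding. Its base symbol \<open>s\<close> is \<open>z\<close>, which
      the opposite block supplies as \<open>xz\<close> times the inverse of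
      \<open>x\<close>.\<close>
    have e: "(True, False, 0) = emb_z k True False 2 (False, 2 * (k - 1) mod k)"
      using k by (simp add: emb_z_def mod_simps)
    have i1: "(i + 1) mod k \<noteq> 0" if "0 \<le> i" "i < k" "i \<noteq> k - 1" for i
      using mod_double_cases[of "i + 1" k] that by auto
    have Jd: "\<exists>i. h = (True, i) \<and> 0 \<le> i \<and> i < k \<and> i \<noteq> k - 1" if "h \<in> J" for h
      using subsetD[OF J that] by auto
    have "\<exists>T. maximal_partial_transversal (switched_square k) T \<and> card T = 2 * nat k + 2 * card J + card {(True, k - 1)}"
      apply (rule switching_embedded[where r_off = "emb_z k False True 2" and r_base = "emb_z k True True 2"
          and c_off = "emb_z k False True 0" and c_base = "emb_z k True True 0"
          and s_base = "emb_z k False False 2" and s_off = "emb_z k True False 2"])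
      apply (simp_all only: inj_on_emb)
      subgoal by (rule image_emb_disjoint(2)[OF k0]) simp
      subgoal by (rule image_emb_disjoint(2)[OF k0]) simp
      subgoal by (rule image_emb_disjoint(2)[OF k0]) simp
      subgoal by (intro Un_least subset_trans[OF J]) (use k in auto)
      subgoal using J by blast
      subgoal for h
      proof -
        assume h': "h \<in> UNIV \<times> {0..<k} - J - {(True, k - 1)}"
        then obtain d i where h: "h = (d, i)" "0 \<le> i" "i < k" by auto
        have "i \<noteq> k - 1" if d using h h' that by simp
        then have "(i + 1) mod k \<noteq> 0" if d using h that i1 by simp
        then show ?thesis
          using s_eq[of h] h h' by (intro emb_z_mem[OF k0]; cases d) (simp_all add: mod_simps)
      qed
      subgoal for h
      proof -
        assume "h \<in> J \<union> {(True, k - 1)}"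
        with J k obtain i where i: "h = (True, i)" "0 \<le> i" "i < k" by auto
        then show ?thesis using s_eq'[of h] by (intro emb_z_mem[OF k0]) simp_all
      qed
      subgoal for h
      proof -
        assume "h \<in> J"
        then obtain i where "h = (True, i)" "0 \<le> i" "i < k" "i \<noteq> k - 1" using Jd by blast
        then show ?thesis using b'_eq[of h] i1[of i] by (intro emb_z_mem[OF k0]) (simp_all add: mod_simps)
      qed
      subgoal for h
      proof -
        assume "h \<in> J"
        then obtain i where "h = (True, i)" "0 \<le> i" "i < k" "i \<noteq> k - 1" using Jd by blast
        then show ?thesis using c'_eq[of h] i1[of i] by (intro emb_z_mem[OF k0]) (simp_all add: mod_simps)
      qed
      subgoal using k by (simp add: emb_z_def switched_square_def switched_op_def coords_def mod_simps)
      subgoal for r c u using emb_z_block[OF k0, of r c u True 2 True 0 False 2] unfolding e by simp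
      done
    then show ?thesis by simp
  qed
qed

lemma omniversal_switched_square:
  assumes k: "k \<ge> 2"
  shows "omniversal (coords k) (switched_square k)"
  unfolding omniversal_def
proof (intro conjI allI impI)
  show "latin_square (coords k) (switched_square k)"
    using latin_square_switched k by simp
next
  fix l :: nat
  have card: "card (coords k) = 4 * nat k"
    by (simp add: coords_def card_cartesian_product)
  assume "\<lceil>real (card (coords k)) / 2\<rceil> \<le> int l \<and> l \<le> card (coords k)"
  then have l: "2 * nat k \<le> l" "l \<le> 4 * nat k"
    unfolding card by linarith+
  show "\<exists>T. maximal_partial_transversal (switched_square k) T \<and> card T = l"
  proof (cases "even l")
    case True
    define j where "j = (l - 2 * nat k) div 2"
    have j: "j \<le> nat k" "l = 2 * nat k + 2 * j" using l True by (auto simp: j_def)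
    \<comment> \<open>\<open>{odd k} \<times> {0..<k}\<close> is the index set \<open>M\<close> of
      whichever table applies; switching all of it reaches length \<open>4k\<close>.\<close>
    have "card ({odd k} \<times> {0..<k}) = nat k" by (simp add: card_cartesian_product)
    then obtain J where "J \<subseteq> {odd k} \<times> {0..<k}" "card J = j"
      using j(1) by (metis obtain_subset_with_card_n)
    then show ?thesis
      using maximal_even_deficiency_even[OF k, of J] maximal_even_deficiency_odd[OF k, of J] j(2)
      by (cases "even k") simp_all
  next
    case False
    then obtain i where "l = 2 * i + 1" by (elim oddE)
    define j where "j = i - nat k"
    have j: "j \<le> nat k - 1" "l = 2 * nat k + 2 * j + 1" using l \<open>l = 2 * i + 1\<close> by (auto simp: j_def)
    define e where "e = (odd k, if even k then 0 else k - 1)"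
    \<comment> \<open>One index is spent on the switched cell (y, y), and the remaining
      \<open>k - 1\<close> just suffice for the largest odd length \<open>4k - 1\<close>.\<close>
    have "card ({odd k} \<times> {0..<k} - {e}) = nat k - 1"
      using k by (simp add: e_def card_cartesian_product)
    then obtain J where "J \<subseteq> {odd k} \<times> {0..<k} - {e}" "card J = j"
      using j(1) by (metis obtain_subset_with_card_n)
    then show ?thesis
      using maximal_odd_deficiency_even[OF k, of J] maximal_odd_deficiency_odd[OF k, of J] j(2)
      unfolding e_def by (cases "even k") simp_all
  qed
qed

section \<open>Relabelling an omniversal square\<close>

text \<open>A longer partial transversal of the relabelled square is the image of a partial
  transversal of \<open>L\<close> of the same length, so it would contradict maximality in
  \<open>L\<close>.\<close>

lemma omniversal_image:
  assumes omni: "omniversal A L" and inj: "inj_on f A"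
  shows "omniversal (f ` A) ((\<lambda>(r, c, s). (f r, f c, f s)) ` L)"
proof -
  let ?F = "\<lambda>(r, c, s). (f r, f c, f s)"
  have latin: "latin_square A L" using omni by (simp add: omniversal_def)
  then have L: "L \<subseteq> A \<times> A \<times> A" by (simp add: latin_square_def)
  have injA: "inj_on ?F (A \<times> A \<times> A)"
    using inj by (auto simp: inj_on_def)
  have mem: "(f r, f c, f s) \<in> ?F ` L \<longleftrightarrow> (r, c, s) \<in> L" if "r \<in> A" "c \<in> A" "s \<in> A" for r c s
    using inj_on_image_mem_iff[OF injA _ L, of "(r, c, s)"] that by simp
  have injF: "inj_on ?F L" using injA L by (rule inj_on_subset)
  have proj: "inj_on (\<lambda>(r, c, s). r) (?F ` S) \<longleftrightarrow> inj_on (\<lambda>(r, c, s). r) S"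
    "inj_on (\<lambda>(r, c, s). c) (?F ` S) \<longleftrightarrow> inj_on (\<lambda>(r, c, s). c) S"
    "inj_on (\<lambda>(r, c, s). s) (?F ` S) \<longleftrightarrow> inj_on (\<lambda>(r, c, s). s) S" if "S \<subseteq> L" for S
  proof -
    have S: "S \<subseteq> A \<times> A \<times> A" using that L by blast
    have SF: "inj_on ?F S" using injF that by (rule inj_on_subset)
    have *: "inj_on g (?F ` S) \<longleftrightarrow> inj_on (g \<circ> ?F) S" for g :: "'b \<times> 'b \<times> 'b \<Rightarrow> 'b"
      using SF by (meson comp_inj_on inj_on_imageI)
    have **: "inj_on (f \<circ> g) S \<longleftrightarrow> inj_on g S" if "g ` S \<subseteq> A" for g :: "'a \<times> 'a \<times> 'a \<Rightarrow> 'a"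
      using inj_on_subset[OF inj that] by (meson comp_inj_on inj_on_imageI2)
    have gS: "(\<lambda>(r, c, s). r) ` S \<subseteq> A" "(\<lambda>(r, c, s). c) ` S \<subseteq> A" "(\<lambda>(r, c, s). s) ` S \<subseteq> A"
      using S by auto
    have comps: "(\<lambda>(r, c, s). r) \<circ> ?F = f \<circ> (\<lambda>(r, c, s). r)" "(\<lambda>(r, c, s). c) \<circ> ?F = f \<circ> (\<lambda>(r, c, s). c)"
      "(\<lambda>(r, c, s). s) \<circ> ?F = f \<circ> (\<lambda>(r, c, s). s)" by auto
    show "inj_on (\<lambda>(r, c, s). r) (?F ` S) \<longleftrightarrow> inj_on (\<lambda>(r, c, s). r) S"
      "inj_on (\<lambda>(r, c, s). c) (?F ` S) \<longleftrightarrow> inj_on (\<lambda>(r, c, s). c) S"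
      "inj_on (\<lambda>(r, c, s). s) (?F ` S) \<longleftrightarrow> inj_on (\<lambda>(r, c, s). s) S"
      unfolding * comps by (rule ** gS)+
  qed
  have pt: "partial_transversal (?F ` L) (?F ` S) \<longleftrightarrow> partial_transversal L S" if "S \<subseteq> L" for S
    using that image_mono[OF that, of ?F] unfolding partial_transversal_def proj[OF that] by blast
  have max: "maximal_partial_transversal (?F ` L) (?F ` T)" if T: "maximal_partial_transversal L T" for T
    unfolding maximal_partial_transversal_def
  proof (intro conjI notI)
    have TL: "T \<subseteq> L" using T by (simp add: maximal_partial_transversal_def partial_transversal_def)
    show "partial_transversal (?F ` L) (?F ` T)"
      using T pt[OF TL] by (simp add: maximal_partial_transversal_def)
    assume "\<exists>T'. partial_transversal (?F ` L) T' \<and> ?F ` T \<subseteq> T' \<and> card (?F ` T) < card T'"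
    then obtain T' where T': "partial_transversal (?F ` L) T'" "?F ` T \<subseteq> T'" "card (?F ` T) < card T'"
      by blast
    then obtain S where S: "S \<subseteq> L" "T' = ?F ` S"
      by (auto simp: partial_transversal_def subset_image_iff)
    have "T \<subseteq> S"
    proof
      fix t assume "t \<in> T"
      then show "t \<in> S"
        using T'(2) S TL inj_on_image_mem_iff[OF injF, of t S] by (meson image_subset_iff subsetD)
    qed
    moreover have "card T < card S"
      using T'(3) S card_image[OF inj_on_subset[OF injF TL]] card_image[OF inj_on_subset[OF injF S(1)]]
      by simp
    moreover have "partial_transversal L S" using T'(1) S pt by simp
    ultimately show False using T by (auto simp: maximal_partial_transversal_def)
  qed
  have card: "card (f ` A) = card A" using inj by (rule card_image)
  have "latin_square (f ` A) (?F ` L)"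
    unfolding latin_square_def
  proof (intro conjI ballI)
    show "finite (f ` A)" using latin by (simp add: latin_square_def)
    show "?F ` L \<subseteq> f ` A \<times> f ` A \<times> f ` A" using L by auto
    \<comment> \<open>Unique existence is transported once for all three conditions on a Latin
      square.\<close>
    have ex1: "\<exists>!w. P w" if "\<exists>!x. Q x" and A: "\<And>x. Q x \<Longrightarrow> x \<in> A" "\<And>w. P w \<Longrightarrow> w \<in> f ` A"
      and PQ: "\<And>x. x \<in> A \<Longrightarrow> P (f x) \<longleftrightarrow> Q x" for P Q
    proof -
      from that(1) obtain x where x: "Q x" "\<And>x'. Q x' \<Longrightarrow> x' = x" by blast
      show ?thesis
      proof (rule ex1I[of _ "f x"])
        show "P (f x)" using x(1) A(1) PQ by blast
        fix w assume "P w"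
        with A(2) obtain x' where "x' \<in> A" "w = f x'" by blast
        moreover from this \<open>P w\<close> have "x' = x" using PQ[of x'] x(2) by simp
        ultimately show "w = f x" by simp
      qed
    qed
    note sub = \<open>?F ` L \<subseteq> f ` A \<times> f ` A \<times> f ` A\<close>
    fix a b assume "a \<in> f ` A" "b \<in> f ` A"
    then obtain x y where xy: "a = f x" "b = f y" "x \<in> A" "y \<in> A" by blast
    have xyL: "\<exists>!s. (x, y, s) \<in> L" "\<exists>!c. (x, c, y) \<in> L" "\<exists>!r. (r, x, y) \<in> L"
      using latin xy by (simp_all add: latin_square_def)
    have inA: "r \<in> A \<and> c \<in> A \<and> s \<in> A" if "(r, c, s) \<in> L" for r c s
      using L that by auto
    have infA: "r \<in> f ` A \<and> c \<in> f ` A \<and> s \<in> f ` A" if "(r, c, s) \<in> ?F ` L" for r c s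
      using subsetD[OF sub that] by auto
    show "\<exists>!s. (a, b, s) \<in> ?F ` L"
      by (rule ex1[OF xyL(1)]) (use inA infA in blast, use infA in blast, simp only: xy mem)
    show "\<exists>!c. (a, c, b) \<in> ?F ` L"
      by (rule ex1[OF xyL(2)]) (use inA infA in blast, use infA in blast, simp only: xy mem)
    show "\<exists>!r. (r, a, b) \<in> ?F ` L"
      by (rule ex1[OF xyL(3)]) (use inA infA in blast, use infA in blast, simp only: xy mem)
  qed
  moreover have "\<exists>T. maximal_partial_transversal (?F ` L) T \<and> card T = l"
    if "\<lceil>real (card A) / 2\<rceil> \<le> int l \<and> l \<le> card A" for l
  proof -
    from omni that have "\<exists>T. maximal_partial_transversal L T \<and> card T = l"
      by (simp add: omniversal_def)
    then obtain T where T: "maximal_partial_transversal L T" "card T = l" by (elim exE conjE)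
    then have "T \<subseteq> L" by (simp add: maximal_partial_transversal_def partial_transversal_def)
    then have "card (?F ` T) = l" using T(2) card_image[OF inj_on_subset[OF injF]] by simp
    with max[OF T(1)] show ?thesis by (intro exI conjI)
  qed
  ultimately show ?thesis
    unfolding omniversal_def card by (intro conjI allI impI)
qed

section \<open>Words, presentations and the model group\<close>

lemma (in group) word_val_closed:
  "range f \<subseteq> carrier G \<Longrightarrow> word_val G f w \<in> carrier G"
  by (induction w) (auto simp: image_subset_iff)

lemma (in group) word_val_append:
  "range f \<subseteq> carrier G \<Longrightarrow> word_val G f (u @ v) = word_val G f u \<otimes> word_val G f v"
proof (induction u)
  case (Cons p u)
  then have "f (fst p) \<in> carrier G" by auto
  with Cons show ?case by (simp add: word_val_closed m_assoc)
qed (simp add: word_val_closed)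

lemma (in group) word_val_replicate:
  "f a \<in> carrier G \<Longrightarrow> word_val G f (replicate n (a, True)) = f a [^] n"
  by (induction n) (simp_all add: group_commutes_pow)

text \<open>Any derivation from \<open>R\<close> can be replayed in a group that satisfies
  \<open>R\<close>. Applied to the model group, this shows that the relations do not collapse
  it.\<close>

lemma (in group) word_eq_sound:
  assumes "word_eq R u v" and f: "range f \<subseteq> carrier G"
    and R: "\<And>u v. (u, v) \<in> R \<Longrightarrow> word_val G f u = word_val G f v"
  shows "word_val G f u = word_val G f v"
  using assms(1)
proof induction
  case (cancel a b)
  have "f a \<in> carrier G" using f by auto
  then show ?case by (cases b) simp_all
next
  case (append u v u' v')
  then show ?case by (simp add: word_val_append[OF f])
qed (simp_all add: R)

text \<open>An element commuting with all generators is central. This is used first for the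
  generators themselves, and then for an arbitrary element, which by the first use commutes with
  every generator.\<close>

lemma (in group) comm_group_of_generators:
  assumes S: "S \<subseteq> carrier G" "generate G S = carrier G"
    and comm: "\<And>a b. a \<in> S \<Longrightarrow> b \<in> S \<Longrightarrow> a \<otimes> b = b \<otimes> a"
  shows "comm_group G"
proof (rule group_comm_groupI)
  have centralizer: "g \<otimes> c = c \<otimes> g"
    if g: "g \<in> generate G S" and c: "c \<in> carrier G" "\<And>a. a \<in> S \<Longrightarrow> a \<otimes> c = c \<otimes> a" for g c
    using g
  proof induction
    case (inv h)
    then have h: "h \<in> carrier G" using S by auto
    have "inv h \<otimes> c = inv h \<otimes> (c \<otimes> h) \<otimes> inv h" using h c(1) by (simp add: m_assoc)
    also have "\<dots> = inv h \<otimes> (h \<otimes> c) \<otimes> inv h" using c(2)[OF inv] by simp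
    also have "\<dots> = c \<otimes> inv h" using h c(1) by (simp add: m_assoc[symmetric])
    finally show ?case .
  next
    case (eng h1 h2)
    then have "h1 \<in> carrier G" "h2 \<in> carrier G" using S(2) by auto
    then show ?case using eng.IH c(1) by (metis m_assoc)
  qed (use c in auto)
  fix g h assume gh: "g \<in> carrier G" "h \<in> carrier G"
  show "g \<otimes> h = h \<otimes> g"
  proof (rule centralizer)
    show "a \<otimes> h = h \<otimes> a" if "a \<in> S" for a
      using centralizer[of h a] that gh S comm by (metis subsetD)
  qed (use gh S in auto)
qed

lemma (in group) int_pow_mod:
  assumes "g \<in> carrier G" "g [^] n = \<one>"
  shows "g [^] (i mod int n) = g [^] i"
proof -
  have "g [^] i = g [^] (int n * (i div int n) + i mod int n)" by simp
  also have "\<dots> = (g [^] int n) [^] (i div int n) \<otimes> g [^] (i mod int n)"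
    using assms(1) by (simp only: int_pow_mult int_pow_pow)
  also have "\<dots> = g [^] (i mod int n)"
    using assms by (simp add: int_pow_int)
  finally show ?thesis by simp
qed

abbreviation (input) model_group :: "nat \<Rightarrow> ((int \<times> int) \<times> int) monoid" where
  "model_group k \<equiv> (integer_mod_group 2 \<times>\<times> integer_mod_group 2) \<times>\<times> integer_mod_group k"

lemma carrier_model_group: "k > 0 \<Longrightarrow> carrier (model_group k) = ({0..<2} \<times> {0..<2}) \<times> {0..<int k}"
  by (simp add: DirProd_def carrier_integer_mod_group)

lemma group_model_group: "group (model_group k)"
  by (intro DirProd_group group_integer_mod_group)

text \<open>The relations make \<open>\<phi>\<close> a homomorphism and generation makes it
  surjective. Injectivity needs the converse half of the presentation: a trivial product is
  derivable from the relations, hence trivial in the model group too.\<close>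

lemma presented_group_iso:
  fixes G (structure)
  assumes pres: "has_presentation G (case_gen x y z) (gen_relations k)" and k: "k \<ge> 2"
  defines "\<phi> \<equiv> \<lambda>((u, v), i). y [^] (u :: int) \<otimes> z [^] (v :: int) \<otimes> x [^] (i :: int)"
  shows "\<phi> \<in> iso (model_group k) G"
proof -
  interpret group G using pres by (simp add: has_presentation_def)
  let ?f = "case_gen x y z"
  have f: "range ?f \<subseteq> carrier G" and gen: "generate G (range ?f) = carrier G"
    and eq: "\<And>u v. word_val G ?f u = word_val G ?f v \<longleftrightarrow> word_eq (gen_relations k) u v"
    using pres by (auto simp: has_presentation_def)
  have range_f: "range (case_gen x y z) = {x, y, z}" for x y z :: 'x
    by (force split: gen.splits simp: image_iff intro: gen.exhaust)
  have xyz: "x \<in> carrier G" "y \<in> carrier G" "z \<in> carrier G" using f by (auto simp: range_f)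
  have rel: "word_val G ?f u = word_val G ?f v" if "(u, v) \<in> gen_relations k" for u v
    using that eq by (blast intro: word_eq.rel)
  have pow: "x [^] k = \<one>" "y [^] (2 :: nat) = \<one>" "z [^] (2 :: nat) = \<one>"
    using rel[of "replicate k (Gen_x, True)" "[]"] rel[of "replicate 2 (Gen_y, True)" "[]"]
      rel[of "replicate 2 (Gen_z, True)" "[]"] xyz
    by (simp_all add: gen_relations_def word_val_replicate)
  have comm: "x \<otimes> y = y \<otimes> x" "x \<otimes> z = z \<otimes> x" "y \<otimes> z = z \<otimes> y"
    using rel[of "[(Gen_x, True), (Gen_y, True)]" "[(Gen_y, True), (Gen_x, True)]"]
      rel[of "[(Gen_x, True), (Gen_z, True)]" "[(Gen_z, True), (Gen_x, True)]"]
      rel[of "[(Gen_y, True), (Gen_z, True)]" "[(Gen_z, True), (Gen_y, True)]"] xyz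
    by (simp_all add: gen_relations_def)
  interpret comm_group G
    by (rule comm_group_of_generators[OF f gen]) (use comm in \<open>auto simp: range_f\<close>)
  let ?K = "model_group k"
  interpret K: group ?K by (rule group_model_group)
  have carK: "carrier ?K = ({0..<2} \<times> {0..<2}) \<times> {0..<int k}"
    by (rule carrier_model_group) (use k in simp)
  have hom: "\<phi> \<in> hom ?K G"
  proof (rule homI)
    fix g h assume "g \<in> carrier ?K" "h \<in> carrier ?K"
    obtain u v i where g: "g = ((u, v), i)" by (metis surj_pair)
    obtain u' v' i' where h: "h = ((u', v'), i')" by (metis surj_pair)
    have "y [^] ((u + u') mod 2) = y [^] u \<otimes> y [^] u'" "z [^] ((v + v') mod 2) = z [^] v \<otimes> z [^] v'"
      "x [^] ((i + i') mod int k) = x [^] i \<otimes> x [^] i'"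
      using int_pow_mod[OF xyz(2) pow(2), of "u + u'"] int_pow_mod[OF xyz(3) pow(3), of "v + v'"]
        int_pow_mod[OF xyz(1) pow(1), of "i + i'"] xyz by (simp_all add: int_pow_mult)
    then show "\<phi> (g \<otimes>\<^bsub>?K\<^esub> h) = \<phi> g \<otimes> \<phi> h"
      using xyz by (simp add: g h \<phi>_def m_ac)
  qed (use xyz in \<open>auto simp: \<phi>_def\<close>)
  interpret \<phi>: group_hom ?K G \<phi>
    by unfold_locales (rule hom)
  have "generate G {x, y, z} \<subseteq> \<phi> ` carrier ?K"
  proof (rule generate_subgroup_incl[OF _ \<phi>.img_is_subgroup])
    have "\<phi> ((0, 0), 1) = x" "\<phi> ((1, 0), 0) = y" "\<phi> ((0, 1), 0) = z"
      using xyz by (simp_all add: \<phi>_def)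
    moreover have "((0, 0), 1) \<in> carrier ?K" "((1, 0), 0) \<in> carrier ?K" "((0, 1), 0) \<in> carrier ?K"
      unfolding carK using k by auto
    ultimately show "{x, y, z} \<subseteq> \<phi> ` carrier ?K" by (metis image_eqI insert_subset empty_subsetI)
  qed
  then have surj: "\<phi> ` carrier ?K = carrier G"
    using gen \<phi>.img_is_subgroup subgroup.subset unfolding range_f by blast
  have inj: "inj_on \<phi> (carrier ?K)"
    unfolding \<phi>.inj_on_one_iff
  proof (intro allI impI)
    fix g assume g: "g \<in> carrier ?K" "\<phi> g = \<one>"
    obtain u v i where uvi: "g = ((u, v), i)" by (metis surj_pair)
    then have range: "0 \<le> u" "u < 2" "0 \<le> v" "v < 2" "0 \<le> i" "i < int k" using g(1) unfolding carK by auto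
    let ?w = "replicate (nat u) (Gen_y, True) @ replicate (nat v) (Gen_z, True) @ replicate (nat i) (Gen_x, True)"
    have "word_val G ?f ?w = \<phi> g"
      using range xyz by (simp add: word_val_append[OF f] word_val_replicate uvi \<phi>_def int_pow_int[symmetric] m_assoc)
    then have "word_eq (gen_relations k) ?w []" using g(2) eq[of ?w "[]"] by simp
    \<comment> \<open>The standard generators of the model satisfy the same relations, and
      \<open>?w\<close> evaluates there to \<open>g\<close> itself.\<close>
    moreover let ?h = "case_gen ((0, 0), 1) ((1, 0), 0) ((0, 1), 0) :: gen \<Rightarrow> (int \<times> int) \<times> int"
    have h: "range ?h \<subseteq> carrier ?K" unfolding carK range_f using k by auto
    have x: "word_val ?K ?h (replicate n (Gen_x, True)) = ((0, 0), int n mod int k)" for n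
      by (induction n) (simp_all add: mod_simps)
    have y: "word_val ?K ?h (replicate n (Gen_y, True)) = ((int n mod 2, 0), 0)" for n
      by (induction n) (simp_all add: mod_simps)
    have z: "word_val ?K ?h (replicate n (Gen_z, True)) = ((0, int n mod 2), 0)" for n
      by (induction n) (simp_all add: mod_simps)
    have "word_val ?K ?h u = word_val ?K ?h v" if "(u, v) \<in> gen_relations k" for u v
      using that x[of k] y[of 2] z[of 2] by (auto simp: gen_relations_def)
    ultimately have "word_val ?K ?h ?w = word_val ?K ?h []"
      using K.word_eq_sound[OF _ h] by blast
    then show "g = \<one>\<^bsub>?K\<^esub>"
      using range by (simp add: K.word_val_append[OF h] x y z uvi)
  qed
  show ?thesis using hom inj surj by (simp add: iso_def bij_betw_def)
qed

section \<open>Identifying \<open>L_star\<close> with the switched square\<close>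

lemma graph_eq_image:
  "{(r, c, s). r \<in> A \<and> c \<in> B \<and> f r c = s} = (\<lambda>(r, c). (r, c, f r c)) ` (A \<times> B)"
  by auto

text \<open>Multiplication by \<open>y\<close> exchanges 1 and \<open>y\<close>, so replacing the
  four entries amounts to multiplying the symbols over the subgroup {1, y} by
  \<open>y\<close>.\<close>

lemma (in group) L_star_eq:
  assumes y: "y \<in> carrier G" "y \<otimes> y = \<one>" "y \<noteq> \<one>"
  shows "L_star G y = (\<lambda>(r, c). (r, c, if r \<in> {\<one>, y} \<and> c \<in> {\<one>, y} then y \<otimes> (r \<otimes> c) else r \<otimes> c))
    ` (carrier G \<times> carrier G)" (is "_ = ?f ` _")
proof (rule Set.set_eqI)
  fix t :: "'a \<times> 'a \<times> 'a"
  obtain r c w where t: "t = (r, c, w)" by (cases t)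
  have "t \<in> cayley_table G \<longleftrightarrow> r \<in> carrier G \<and> c \<in> carrier G \<and> w = r \<otimes> c"
    by (auto simp: cayley_table_def t)
  moreover have "t \<in> ?f ` (carrier G \<times> carrier G) \<longleftrightarrow> r \<in> carrier G \<and> c \<in> carrier G \<and>
      w = (if r \<in> {\<one>, y} \<and> c \<in> {\<one>, y} then y \<otimes> (r \<otimes> c) else r \<otimes> c)"
    unfolding t graph_eq_image[symmetric] by auto
  ultimately show "t \<in> L_star G y \<longleftrightarrow> t \<in> ?f ` (carrier G \<times> carrier G)"
    using y unfolding L_star_def Un_iff Diff_iff
    by (cases "r = \<one>"; cases "r = y"; cases "c = \<one>"; cases "c = y") (simp_all add: t)
qed

theorem theorem2p3:
  fixes G :: "('a, 'b) monoid_scheme" and x y z :: 'a and m q :: nat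
  assumes "m > 0"
    and "q \<in> {0, 1}"
    and "has_presentation G (case_gen x y z) (gen_relations (2 * m + q))"
  shows "G \<cong> (integer_mod_group 2 \<times>\<times> integer_mod_group 2) \<times>\<times> integer_mod_group (2 * m + q)
         \<and> order G = 8 * m + 4 * q
         \<and> omniversal (carrier G) (L_star G y)"
proof -
  define k where "k = 2 * m + q"
  have k: "k \<ge> 2" using assms(1) by (simp add: k_def)
  define \<phi> where "\<phi> = (\<lambda>((u, v), i). y [^]\<^bsub>G\<^esub> (u :: int) \<otimes>\<^bsub>G\<^esub> z [^]\<^bsub>G\<^esub> (v :: int) \<otimes>\<^bsub>G\<^esub> x [^]\<^bsub>G\<^esub> (i :: int))"
  have iso: "\<phi> \<in> iso (model_group k) G"
    unfolding \<phi>_def by (rule presented_group_iso[OF assms(3)[folded k_def] k])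
  interpret group G using assms(3) by (simp add: has_presentation_def)
  have car: "carrier (model_group k) = ({0..<2} \<times> {0..<2}) \<times> {0..<int k}"
    by (rule carrier_model_group) (use k in simp)
  have bij: "bij_betw \<phi> (({0..<2} \<times> {0..<2}) \<times> {0..<int k}) (carrier G)"
    using iso unfolding iso_def car by simp
  have mult: "\<phi> ((u, v), i) \<otimes>\<^bsub>G\<^esub> \<phi> ((u', v'), j) = \<phi> (((u + u') mod 2, (v + v') mod 2), (i + j) mod int k)"
    if "((u, v), i) \<in> carrier (model_group k)" "((u', v'), j) \<in> carrier (model_group k)" for u v i u' v' j
    using iso_imp_homomorphism[OF iso, THEN hom_mult, OF that] by simp
  define \<psi> where "\<psi> = (\<lambda>(u, v, i). \<phi> ((of_bool u, of_bool v), i))"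
  have inj: "inj_on \<psi> (coords (int k))"
  proof (rule inj_onI)
    fix g h assume gh: "g \<in> coords (int k)" "h \<in> coords (int k)" "\<psi> g = \<psi> h"
    obtain u v i u' v' j where e: "g = (u, v, i)" "h = (u', v', j)" by (metis surj_pair)
    have "((of_bool u, of_bool v), i) = ((of_bool u' :: int, of_bool v' :: int), j)"
      using gh bij_betw_imp_inj_on[OF bij] unfolding e \<psi>_def
      by (intro inj_onD[OF bij_betw_imp_inj_on[OF bij]]) (auto simp: coords_def)
    then show "g = h" by (simp add: e of_bool_eq_iff)
  qed
  have card_G: "card (carrier G) = 4 * k"
    using bij_betw_same_card[OF bij] by (simp add: card_cartesian_product)
  have "\<psi> ` coords (int k) \<subseteq> carrier G"
    using bij_betw_imp_surj_on[OF bij] by (auto simp: \<psi>_def coords_def)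
  moreover have "card (\<psi> ` coords (int k)) = card (carrier G)"
    using card_image[OF inj] by (simp add: card_G coords_def card_cartesian_product)
  moreover have "finite (carrier G)" using card_G k by (simp add: card_ge_0_finite)
  ultimately have surj: "\<psi> ` coords (int k) = carrier G" by (intro card_subset_eq)
  have \<psi>_mult: "\<psi> (u, v, i) \<otimes>\<^bsub>G\<^esub> \<psi> (u', v', j) = \<psi> (u \<noteq> u', v \<noteq> v', (i + j) mod int k)"
    if "(u, v, i) \<in> coords (int k)" "(u', v', j) \<in> coords (int k)" for u v i u' v' j
  proof -
    have "(of_bool d + of_bool d') mod 2 = (of_bool (d \<noteq> d') :: int)" for d d'
      by (cases d; cases d') simp_all
    moreover have "((of_bool u, of_bool v), i) \<in> carrier (model_group k)" "((of_bool u', of_bool v'), j) \<in> carrier (model_group k)"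
      unfolding car using that by (auto simp: coords_def)
    ultimately show ?thesis using mult by (simp add: \<psi>_def del: carrier_DirProd mult_DirProd)
  qed
  have "range (case_gen x y z) \<subseteq> carrier G" using assms(3) by (simp add: has_presentation_def)
  then have xyz: "case_gen x y z g \<in> carrier G" for g by blast
  have y: "y = \<psi> (True, False, 0)" "\<one>\<^bsub>G\<^esub> = \<psi> (False, False, 0)"
    using xyz[of Gen_y] by (simp_all add: \<psi>_def \<phi>_def)
  have in_coords: "(d, d', 0) \<in> coords (int k)" for d d' using k by (simp add: coords_def)
  \<comment> \<open>The relations alone would allow \<open>y\<close> to be trivial; the injectivity
    of \<open>\<psi>\<close>, which comes from the presentation, rules this out.\<close>
  have y2: "y \<otimes>\<^bsub>G\<^esub> y = \<one>\<^bsub>G\<^esub>" "y \<noteq> \<one>\<^bsub>G\<^esub>"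
    using \<psi>_mult[OF in_coords in_coords, of True False True False] inj_on_eq_iff[OF inj in_coords in_coords, of True False False False]
    by (simp_all add: y)
  \<comment> \<open>By injectivity of \<open>\<psi>\<close>, an element lies in {1, y} exactly when
    its exponents of \<open>z\<close> and \<open>x\<close> vanish, which is the flip condition of
    \<open>switched_op\<close>.\<close>
  have op: "\<psi> (switched_op (int k) g h) = (if \<psi> g \<in> {\<one>\<^bsub>G\<^esub>, y} \<and> \<psi> h \<in> {\<one>\<^bsub>G\<^esub>, y}
      then y \<otimes>\<^bsub>G\<^esub> (\<psi> g \<otimes>\<^bsub>G\<^esub> \<psi> h) else \<psi> g \<otimes>\<^bsub>G\<^esub> \<psi> h)"
    if gh: "g \<in> coords (int k)" "h \<in> coords (int k)" for g h
  proof -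
    obtain u v i u' v' j where e: "g = (u, v, i)" "h = (u', v', j)" by (metis surj_pair)
    have mem: "\<psi> (d, d', l) \<in> {\<one>\<^bsub>G\<^esub>, y} \<longleftrightarrow> \<not> d' \<and> l = 0" if "(d, d', l) \<in> coords (int k)" for d d' l
      unfolding y insert_iff empty_iff inj_on_eq_iff[OF inj that in_coords] by auto
    have sum: "(d, d', (i + j) mod int k) \<in> coords (int k)" for d d'
      using k by (simp add: coords_def)
    have "y \<otimes>\<^bsub>G\<^esub> \<psi> (d, d', (i + j) mod int k) = \<psi> (\<not> d, d', (i + j) mod int k)" for d d'
      unfolding y(1) using \<psi>_mult[OF in_coords sum, of True False d d'] by simp
    then show ?thesis
      using gh unfolding e by (simp only: \<psi>_mult mem) (simp add: switched_op_def)
  qed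
  have L_star: "L_star G y = (\<lambda>(r, c, s). (\<psi> r, \<psi> c, \<psi> s)) ` switched_square (int k)"
  proof -
    have "switched_square (int k) = (\<lambda>(g, h). (g, h, switched_op (int k) g h)) ` (coords (int k) \<times> coords (int k))"
      unfolding switched_square_def by (rule graph_eq_image)
    then have "(\<lambda>(r, c, s). (\<psi> r, \<psi> c, \<psi> s)) ` switched_square (int k) =
        (\<lambda>(g, h). (\<psi> g, \<psi> h, \<psi> (switched_op (int k) g h))) ` (coords (int k) \<times> coords (int k))"
      by (simp add: image_image split_beta)
    also have "\<dots> = L_star G y"
      unfolding L_star_eq[OF xyz[of Gen_y, simplified] y2] surj[symmetric]
        map_prod_surj_on[OF HOL.refl HOL.refl, symmetric] image_image
      by (rule image_cong[OF HOL.refl]) (auto simp only: op map_prod_simp prod.case SigmaE mem_Sigma_iff split: prod.split)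
    finally show ?thesis by simp
  qed
  have "omniversal (carrier G) (L_star G y)"
    unfolding L_star surj[symmetric]
    by (rule omniversal_image[OF omniversal_switched_square inj]) (use k in simp)
  moreover have "order G = 8 * m + 4 * q"
    using card_G by (simp add: order_def k_def)
  moreover have "G \<cong> model_group k"
    using group.iso_sym[OF group_model_group] iso unfolding is_iso_def by blast
  ultimately show ?thesis by (simp add: k_def)
qed

end
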